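(* Let $\mu_u$ be a positive Borel measure on $\mathbb{D}$ with $\int_{\mathbb{D}}(1-|\zeta|)\,d\mu_u(\zeta)<\infty$, and let $$u(z)=\int_{\mathbb{D}}\log\frac{|z-\zeta|}{|1-z\bar\zeta|}\,d\mu_u(\zeta),\quad z\in\mathbb{D}.$$ Let $\alpha\in[0,1)$ and $p\in(1,\infty)$ satisfy $\alpha+\frac1p<1$. Suppose that $\operatorname{supp}\mu_u$ is contained in a finite number of Stolz angles with vertices on $\partial\mathbb{D}$. Then $$m_p(r,u)=O\bigl((1-r)^{-\alpha}\bigr),\quad r\uparrow1,$$ holds if and only if $$n(r,u):=\mu_u\bigl(\overline{D(0,r)}\bigr)=O\bigl((1-r)^{-\alpha-\frac1p}\bigr),\quad r\uparrow1.$$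
   Context: $\mathbb{D}=\{z\in\mathbb{C}:|z|<1\}$, $D(z,r)=\{\zeta\in\mathbb{C}:|\zeta-z|<r\}$. For $u$ subharmonic in $\mathbb{D}$ and $p\ge1$, $m_p(r,u)=\bigl(\frac1{2\pi}\int_0^{2\pi}|u(re^{i\theta})|^p\,d\theta\bigr)^{1/p}$, $0<r<1$. A Stolz angle with vertex $\xi\in\partial\mathbb{D}$ is a set of the form $\{z\in\mathbb{D}:|\xi-z|<c(1-|z|)\}$ with a constant $c>1$. The measure $\mu_u$ is the Riesz measure of $u$. *)

theory Defs
  imports "HOL-Analysis.Analysis"
begin

definition stolz_angle :: "complex \<Rightarrow> real \<Rightarrow> complex set" where
  "stolz_angle \<xi> c = {z \<in> ball 0 1. norm (\<xi> - z) < c * (1 - norm z)}"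

(* Closed support, relative to space M. It is meant for M with
   sets M = sets (restrict_space borel (space M)), so that every U \<inter> space M is measurable. *)
definition measure_support :: "'a::topological_space measure \<Rightarrow> 'a set" where
  "measure_support M =
     {x \<in> space M. \<forall>U. open U \<longrightarrow> x \<in> U \<longrightarrow> emeasure M (U \<inter> space M) > 0}"

(* log (|z - \<zeta>| / |1 - z cnj \<zeta>|). The diagonal value is -\<infinity>; the library's ln 0 = 0 would
   lose the mass that a measure has at z. *)
definition log_kernel :: "complex \<Rightarrow> complex \<Rightarrow> ereal" where
  "log_kernel z \<zeta> =
     (if z = \<zeta> then -\<infinity> else ereal (ln (norm (z - \<zeta>) / norm (1 - z * cnj \<zeta>))))"

(* On the unit disc log_kernel is nonpositive, so its integral, with values in [-\<infinity>, 0],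
   is minus the nonnegative integral of -log_kernel. *)
definition green_potential :: "complex measure \<Rightarrow> complex \<Rightarrow> ereal" where
  "green_potential M z = - enn2ereal (\<integral>\<^sup>+ \<zeta>. e2ennreal (- log_kernel z \<zeta>) \<partial>M)"

(* Real powers on [0, \<infinity>] with \<infinity> to the power p equal to \<infinity>; only used for p > 0. *)
definition ennreal_powr :: "ennreal \<Rightarrow> real \<Rightarrow> ennreal" where
  "ennreal_powr x p = (if x = \<infinity> then \<infinity> else ennreal (enn2real x powr p))"

definition integral_mean :: "real \<Rightarrow> real \<Rightarrow> (complex \<Rightarrow> ereal) \<Rightarrow> ennreal" where
  "integral_mean p r u =
     ennreal_powr
       (ennreal (1 / (2 * pi)) *
         (\<integral>\<^sup>+ \<theta>\<in>{0..2 * pi}. ennreal_powr (e2ennreal \<bar>u (of_real r * cis \<theta>)\<bar>) p \<partial>lborel))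
       (1 / p)"

(* f r = O(g r) as r increases to 1, for f with values in [0, \<infinity>]; in particular f is finite
   near 1. The library's O[F](g) requires real-valued f, and converting f with enn2real would
   turn the value \<infinity> into 0. *)
definition bigo_at_left_one :: "(real \<Rightarrow> ennreal) \<Rightarrow> (real \<Rightarrow> real) \<Rightarrow> bool" where
  "bigo_at_left_one f g \<longleftrightarrow>
     (\<exists>C::real. \<forall>\<^sub>F r in at_left 1. f r \<le> ennreal (C * g r))"

end

theory Submission
  imports Defs
begin

text \<open>
  Write \<open>K(z, \<zeta>)\<close> for the negative of the logarithmic kernel, so that
  \<open>\<bar>u(z)\<bar> = \<integral> K(z, \<zeta>) d\<mu>(\<zeta>)\<close>, and measure points by their distance from the circle:
  \<open>t = 1 - r\<close>, \<open>s = 1 - \<bar>\<zeta>\<bar>\<close>, \<open>m = max s t\<close>. Put \<open>\<beta> = \<alpha> + 1/p\<close>, and let \<open>n(t)\<close> be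
  the mass of \<open>{s \<ge> t}\<close>. Both directions rest on the identity
  \<open>K(z, \<zeta>) = ln (1 + (1 - \<bar>z\<bar>^2) (1 - \<bar>\<zeta>\<bar>^2) / \<bar>z - \<zeta>\<bar>^2) / 2\<close>
  (\<open>green_kernel_eq_ln\<close>).

  From means to masses. If \<open>z\<close> lies on the circle of radius \<open>1 - t\<close> within \<open>2 t\<close> of the vertex of
  a Stolz angle, and \<open>\<zeta>\<close> lies in that angle with \<open>t \<le> s < 2 t\<close>, then \<open>z\<close> and \<open>\<zeta>\<close> are at bounded
  hyperbolic distance, hence \<open>K(z, \<zeta>)\<close> is bounded below by a constant
  (\<open>green_kernel_ge_in_stolz_angle\<close>). Such \<open>z\<close> fill an arc of length comparable to \<open>t\<close>, so the
  \<open>p\<close>-th mean is at least a constant times \<open>t^(1/p)\<close> times the mass of the part of the layer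
  \<open>t \<le> s < 2 t\<close> in the angle (\<open>mass_layer_le_integral_mean\<close>). Summing over the finitely many
  angles gives \<open>n(t) \<le> n(2 t) + M t^(-\<beta>)\<close>, and iterating this over dyadic scales gives
  \<open>n(t) = O(t^(-\<beta>))\<close> (\<open>dyadic_recursion_bound\<close>).

  From masses to means. Minkowski's integral inequality bounds the \<open>p\<close>-th mean of \<open>u\<close> by the
  \<open>\<mu>\<close>-integral of the \<open>p\<close>-th means of \<open>K(., \<zeta>)\<close>. The latter are at most a constant times
  \<open>w(s, t) = (s t / m^2) m^(1/p)\<close> (\<open>green_kernel_mean_bound\<close>): away from \<open>\<zeta>\<close> the kernel is at most
  of order \<open>s t / \<bar>z - \<zeta>\<bar>^2\<close>, and its logarithmic singularity is milder than any negative power.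
  Cutting the disc into dyadic layers, the bound on \<open>n\<close> turns \<open>\<integral> w d\<mu>\<close> into two geometric series
  (\<open>nn_integral_radial_weight_le\<close>). The one over \<open>s \<ge> t\<close> has ratio \<open>2^(-1-\<alpha>)\<close>, the one over
  \<open>s < t\<close> has ratio \<open>2^(\<beta>-1)\<close> and converges because \<open>\<beta> < 1\<close>; both add up to \<open>O(t^(-\<alpha>))\<close>.
\<close>

section \<open>Powers and Minkowski's integral inequality for extended nonnegative functions\<close>

lemma ennreal_powr_ennreal [simp]: "0 \<le> x \<Longrightarrow> ennreal_powr (ennreal x) p = ennreal (x powr p)"
  by (simp add: ennreal_powr_def)

lemma ennreal_powr_top [simp]: "ennreal_powr top p = top"
  by (simp add: ennreal_powr_def)

lemma ennreal_powr_0 [simp]: "ennreal_powr 0 p = 0"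
  by (simp add: ennreal_powr_def)

lemma ennreal_powr_mono:
  assumes "x \<le> y" "0 \<le> p"
  shows "ennreal_powr x p \<le> ennreal_powr y p"
proof (cases y)
  case (real b)
  then obtain a where "x = ennreal a" "0 \<le> a" "a \<le> b"
    using assms(1) by (cases x) (auto simp: top_unique)
  then show ?thesis
    using real assms by (simp add: ennreal_leI powr_mono2)
qed simp

text \<open>
  The conventions \<open>0 * \<infinity> = 0\<close> and \<open>0 powr p = 0\<close> agree when one factor vanishes and the other is
  infinite.
\<close>
lemma ennreal_powr_mult: "ennreal_powr (x * y) p = ennreal_powr x p * ennreal_powr y p"
proof (cases "x = 0 \<or> y = 0")
  case False
  show ?thesis
  proof (cases "x = top \<or> y = top")
    case True
    have "ennreal_powr z p \<noteq> 0" if "z \<noteq> 0" for z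
      using that by (cases z) auto
    then have "ennreal_powr x p \<noteq> 0" "ennreal_powr y p \<noteq> 0"
      using False by simp_all
    with True False show ?thesis
      by (elim disjE) (simp_all add: ennreal_mult_top ennreal_top_mult)
  next
    case False
    then obtain a b where "x = ennreal a" "0 \<le> a" "y = ennreal b" "0 \<le> b"
      by (metis enn2real_nonneg ennreal_enn2real_if)
    then show ?thesis
      by (simp add: powr_mult flip: ennreal_mult)
  qed
qed auto

lemma ennreal_powr_inverse:
  "p \<noteq> 0 \<Longrightarrow> ennreal_powr (ennreal_powr x p) (1 / p) = x"
  by (cases x) (auto simp: powr_powr)

lemma measurable_ennreal_powr [measurable]: "(\<lambda>x. ennreal_powr x p) \<in> borel_measurable borel"
  unfolding ennreal_powr_def by measurable

lemma ennreal_powr_indicator: "ennreal_powr (x * indicator A y) p = ennreal_powr x p * indicator A y"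
  by (auto simp: indicator_def)

text \<open>
  The tangent line of the concave \<open>p\<close>-th root at \<open>l powr p\<close>, evaluated at \<open>x powr p\<close>, in the form of Young's inequality. A free
  parameter \<open>l\<close> lets one integrate first and optimise afterwards.
\<close>
lemma Young_ennreal:
  assumes p: "1 < p" and l: "0 < l"
  shows "x \<le> ennreal (l powr (1 - p) / p) * ennreal_powr x p + ennreal ((1 - 1 / p) * l)"
proof (cases x)
  case (real a)
  have "a \<le> l powr (1 - p) / p * a powr p + (1 - 1 / p) * l"
  proof (cases "a = 0")
    case False
    then have a: "0 < a" using real by simp
    have "a = (l powr (1 - p) * a powr p) powr (1 / p) * l powr (1 - 1 / p)"
      using a l p by (simp add: powr_mult powr_powr flip: powr_add) (simp add: field_simps powr_zero_eq_one)
    also have "\<dots> \<le> (1 / p) * (l powr (1 - p) * a powr p) + (1 - 1 / p) * l"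
      using a l p by (intro Youngs_inequality_0) auto
    finally show ?thesis by simp
  qed (use p l in simp)
  then show ?thesis
    using real p l by (simp add: ennreal_leI flip: ennreal_mult ennreal_plus)
next
  case top
  then show ?thesis using p l by (simp add: ennreal_mult_top)
qed

text \<open>
  Jensen's inequality for the measure with density \<open>w\<close>, not normalised to total mass \<open>1\<close>; an upper
  bound \<open>G\<close> of its mass suffices. Young's inequality is integrated with a fixed parameter \<open>l\<close>, which
  is then chosen from an upper bound of the right-hand integral.
\<close>
lemma Jensen_powr_weighted:
  assumes [measurable]: "f \<in> borel_measurable M" "w \<in> borel_measurable M"
    and p: "1 < p" and G: "0 < G" and wG: "(\<integral>\<^sup>+ x. w x \<partial>M) \<le> ennreal G"
  shows "ennreal_powr (\<integral>\<^sup>+ x. f x * w x \<partial>M) p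
    \<le> ennreal (G powr (p - 1)) * (\<integral>\<^sup>+ x. ennreal_powr (f x) p * w x \<partial>M)"
    (is "ennreal_powr ?F p \<le> _ * ?A")
proof -
  have le: "ennreal_powr ?F p \<le> ennreal (G powr (p - 1)) * ennreal b"
    if b: "0 < b" and Ab: "?A \<le> ennreal b" for b
  proof -
    \<comment> \<open>the value of the parameter that balances both terms of Young's inequality\<close>
    define l where "l = (b / G) powr (1 / p)"
    have l: "0 < l" using b G by (simp add: l_def)
    have lp: "l powr p = b / G" using b G p by (simp add: l_def powr_powr)
    have "?F \<le> (\<integral>\<^sup>+ x. (ennreal (l powr (1 - p) / p) * ennreal_powr (f x) p
        + ennreal ((1 - 1 / p) * l)) * w x \<partial>M)"
      by (intro nn_integral_mono mult_right_mono Young_ennreal p l) auto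
    also have "\<dots> = (\<integral>\<^sup>+ x. ennreal (l powr (1 - p) / p) * (ennreal_powr (f x) p * w x)
        + ennreal ((1 - 1 / p) * l) * w x \<partial>M)"
      by (simp add: distrib_right mult.assoc)
    also have "\<dots> = ennreal (l powr (1 - p) / p) * ?A
        + ennreal ((1 - 1 / p) * l) * (\<integral>\<^sup>+ x. w x \<partial>M)"
      by (simp add: nn_integral_add nn_integral_cmult)
    also have "\<dots> \<le> ennreal (l powr (1 - p) / p) * ennreal b + ennreal ((1 - 1 / p) * l) * ennreal G"
      by (intro add_mono mult_left_mono Ab wG) auto
    also have "\<dots> = ennreal (l powr (1 - p) / p * b + (1 - 1 / p) * l * G)"
      using p b G l by (simp flip: ennreal_mult ennreal_plus)
    also have "l powr (1 - p) / p * b + (1 - 1 / p) * l * G = l * G"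
      using p G b l lp by (simp add: powr_diff field_simps)
    finally have "ennreal_powr ?F p \<le> ennreal_powr (ennreal (l * G)) p"
      using p by (intro ennreal_powr_mono) auto
    also have "\<dots> = ennreal (G powr (p - 1) * b)"
      using l G lp p by (simp add: powr_mult powr_diff mult.commute)
    finally show ?thesis using b by (simp add: ennreal_mult)
  qed
  show ?thesis
  proof (cases ?A)
    case (real a)
    show ?thesis
    proof (cases "a = 0")
      \<comment> \<open>If \<open>?A\<close> vanishes there is no optimal parameter; every bound \<open>e > 0\<close> is used instead.\<close>
      case True
      then have A0: "?A = 0" using real by simp
      have "ennreal_powr ?F p \<le> ennreal e" if "0 < e" for e
        using le[of "e / G powr (p - 1)"] that G A0 by (simp flip: ennreal_mult)
      then have "ennreal_powr ?F p = 0"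
        by (metis ennreal_le_epsilon add_0 le_zero_eq)
      then show ?thesis by simp
    qed (use real le[of a] in simp)
  next
    case top
    have "G powr (p - 1) > 0" using G by simp
    then show ?thesis unfolding top by (simp add: ennreal_mult_top)
  qed
qed

text \<open>
  The function \<open>g\<close> majorises the \<open>L^p\<close> norms of the slices \<open>K(., \<zeta>)\<close>. Writing \<open>K = (K / g) g\<close> and
  applying Jensen's inequality to the measure with density \<open>g\<close> makes the \<open>p\<close>-th power pass inside the
  \<open>\<zeta>\<close>-integral; Fubini's theorem then integrates each slice separately.
\<close>
lemma Minkowski_integral_inequality:
  fixes K :: "'a \<Rightarrow> 'b \<Rightarrow> ennreal" and g :: "'b \<Rightarrow> real"
  assumes "sigma_finite_measure L" "sigma_finite_measure M"
    and K [measurable]: "(\<lambda>(\<theta>, \<zeta>). K \<theta> \<zeta>) \<in> borel_measurable (L \<Otimes>\<^sub>M M)"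
    and g [measurable]: "g \<in> borel_measurable M"
    and p: "1 < p"
    and g_pos: "\<And>\<zeta>. \<zeta> \<in> space M \<Longrightarrow> 0 < g \<zeta>"
    and slice: "\<And>\<zeta>. \<zeta> \<in> space M \<Longrightarrow>
      (\<integral>\<^sup>+ \<theta>. ennreal_powr (K \<theta> \<zeta>) p \<partial>L) \<le> ennreal (g \<zeta> powr p)"
    and G: "0 < G" and gG: "(\<integral>\<^sup>+ \<zeta>. ennreal (g \<zeta>) \<partial>M) \<le> ennreal G"
  shows "(\<integral>\<^sup>+ \<theta>. ennreal_powr (\<integral>\<^sup>+ \<zeta>. K \<theta> \<zeta> \<partial>M) p \<partial>L) \<le> ennreal (G powr p)"
proof -
  interpret L: sigma_finite_measure L by fact
  interpret M: sigma_finite_measure M by fact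
  interpret LM: pair_sigma_finite L M ..
  have "(\<integral>\<^sup>+ \<theta>. ennreal_powr (\<integral>\<^sup>+ \<zeta>. K \<theta> \<zeta> \<partial>M) p \<partial>L)
    \<le> (\<integral>\<^sup>+ \<theta>. ennreal (G powr (p - 1)) *
        (\<integral>\<^sup>+ \<zeta>. ennreal_powr (K \<theta> \<zeta>) p * ennreal (g \<zeta> powr (1 - p)) \<partial>M) \<partial>L)"
  proof (rule nn_integral_mono)
    fix \<theta> assume \<theta> [measurable]: "\<theta> \<in> space L"
    have "(\<integral>\<^sup>+ \<zeta>. K \<theta> \<zeta> \<partial>M) = (\<integral>\<^sup>+ \<zeta>. (K \<theta> \<zeta> * ennreal (1 / g \<zeta>)) * ennreal (g \<zeta>) \<partial>M)"
    proof (rule nn_integral_cong)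
      fix \<zeta> assume "\<zeta> \<in> space M"
      then have "ennreal (1 / g \<zeta>) * ennreal (g \<zeta>) = 1"
        using g_pos[of \<zeta>] by (simp flip: ennreal_mult)
      then show "K \<theta> \<zeta> = (K \<theta> \<zeta> * ennreal (1 / g \<zeta>)) * ennreal (g \<zeta>)"
        by (simp only: mult.assoc mult_1_right)
    qed
    moreover have "(\<integral>\<^sup>+ \<zeta>. ennreal_powr (K \<theta> \<zeta> * ennreal (1 / g \<zeta>)) p * ennreal (g \<zeta>) \<partial>M)
      = (\<integral>\<^sup>+ \<zeta>. ennreal_powr (K \<theta> \<zeta>) p * ennreal (g \<zeta> powr (1 - p)) \<partial>M)"
    proof (rule nn_integral_cong)
      fix \<zeta> assume "\<zeta> \<in> space M"
      then have "ennreal_powr (ennreal (1 / g \<zeta>)) p * ennreal (g \<zeta>) = ennreal (g \<zeta> powr (1 - p))"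
        using g_pos[of \<zeta>] by (simp add: powr_divide powr_diff flip: ennreal_mult)
      then show "ennreal_powr (K \<theta> \<zeta> * ennreal (1 / g \<zeta>)) p * ennreal (g \<zeta>)
        = ennreal_powr (K \<theta> \<zeta>) p * ennreal (g \<zeta> powr (1 - p))"
        by (simp only: mult.assoc ennreal_powr_mult)
    qed
    moreover have "(\<lambda>\<zeta>. K \<theta> \<zeta> * ennreal (1 / g \<zeta>)) \<in> borel_measurable M"
      by measurable
    ultimately show "ennreal_powr (\<integral>\<^sup>+ \<zeta>. K \<theta> \<zeta> \<partial>M) p \<le> ennreal (G powr (p - 1)) *
        (\<integral>\<^sup>+ \<zeta>. ennreal_powr (K \<theta> \<zeta>) p * ennreal (g \<zeta> powr (1 - p)) \<partial>M)"
      using Jensen_powr_weighted[of "\<lambda>\<zeta>. K \<theta> \<zeta> * ennreal (1 / g \<zeta>)" M "\<lambda>\<zeta>. ennreal (g \<zeta>)" p G]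
        p G gG by simp
  qed
  also have "\<dots> = ennreal (G powr (p - 1)) *
      (\<integral>\<^sup>+ \<theta>. (\<integral>\<^sup>+ \<zeta>. ennreal_powr (K \<theta> \<zeta>) p * ennreal (g \<zeta> powr (1 - p)) \<partial>M) \<partial>L)"
    by (intro nn_integral_cmult) measurable
  also have "(\<integral>\<^sup>+ \<theta>. (\<integral>\<^sup>+ \<zeta>. ennreal_powr (K \<theta> \<zeta>) p * ennreal (g \<zeta> powr (1 - p)) \<partial>M) \<partial>L)
      = (\<integral>\<^sup>+ \<zeta>. (\<integral>\<^sup>+ \<theta>. ennreal_powr (K \<theta> \<zeta>) p * ennreal (g \<zeta> powr (1 - p)) \<partial>L) \<partial>M)"
    by (rule LM.Fubini'[symmetric]) measurable
  also have "\<dots> \<le> (\<integral>\<^sup>+ \<zeta>. ennreal (g \<zeta>) \<partial>M)"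
  proof (rule nn_integral_mono)
    fix \<zeta> assume \<zeta> [measurable]: "\<zeta> \<in> space M"
    have "(\<integral>\<^sup>+ \<theta>. ennreal_powr (K \<theta> \<zeta>) p * ennreal (g \<zeta> powr (1 - p)) \<partial>L)
        = (\<integral>\<^sup>+ \<theta>. ennreal_powr (K \<theta> \<zeta>) p \<partial>L) * ennreal (g \<zeta> powr (1 - p))"
      by (intro nn_integral_multc) measurable
    also have "\<dots> \<le> ennreal (g \<zeta> powr p) * ennreal (g \<zeta> powr (1 - p))"
      by (intro mult_right_mono slice \<zeta>) simp
    also have "\<dots> = ennreal (g \<zeta>)"
      using g_pos[OF \<zeta>] by (simp flip: ennreal_mult powr_add)
    finally show "(\<integral>\<^sup>+ \<theta>. ennreal_powr (K \<theta> \<zeta>) p * ennreal (g \<zeta> powr (1 - p)) \<partial>L) \<le> ennreal (g \<zeta>)" .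
  qed
  also have "\<dots> \<le> ennreal G" by fact
  also have "ennreal (G powr (p - 1)) * ennreal G = ennreal (G powr p)"
    using G by (simp add: powr_diff flip: ennreal_mult)
  finally show ?thesis by (simp add: mult_left_mono)
qed

section \<open>The Green kernel of the disc and its singularity\<close>

text \<open>
  The Green function of the disc as a nonnegative extended function, with value \<open>\<infinity>\<close> on the diagonal.
\<close>
definition green_kernel :: "complex \<Rightarrow> complex \<Rightarrow> ennreal" where
  "green_kernel z \<zeta> = e2ennreal (- log_kernel z \<zeta>)"

lemma norm_one_minus_mult_cnj:
  "(norm (1 - z * cnj w))\<^sup>2 = (norm (z - w))\<^sup>2 + (1 - (norm z)\<^sup>2) * (1 - (norm w)\<^sup>2)"
  unfolding cmod_power2 by (simp add: power2_eq_square algebra_simps)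

text \<open>
  The quotient \<open>\<bar>1 - z cnj w\<bar>^2 / \<bar>z - w\<bar>^2\<close> exceeds \<open>1\<close> by exactly the fraction below, so the size
  of the kernel is read off from the distances of \<open>z\<close> and \<open>w\<close> to the circle and to each other.
\<close>
lemma green_kernel_eq_ln:
  assumes "norm z < 1" "norm w < 1" "z \<noteq> w"
  shows "green_kernel z w =
    ennreal (ln (1 + (1 - (norm z)\<^sup>2) * (1 - (norm w)\<^sup>2) / (norm (z - w))\<^sup>2) / 2)"
proof -
  let ?N = "norm (1 - z * cnj w)" and ?d = "norm (z - w)"
  have d: "0 < ?d" using assms by simp
  have "0 < (1 - (norm z)\<^sup>2) * (1 - (norm w)\<^sup>2)"
    using assms by (intro mult_pos_pos) (auto simp: power_less_one_iff)
  then have "0 < ?N\<^sup>2" using d norm_one_minus_mult_cnj[of z w] by (simp add: add_pos_pos)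
  then have N: "0 < ?N" by (simp add: zero_less_power2)
  have "1 + (1 - (norm z)\<^sup>2) * (1 - (norm w)\<^sup>2) / ?d\<^sup>2 = (?N / ?d)\<^sup>2"
    using d norm_one_minus_mult_cnj[of z w] by (simp add: field_simps)
  then have "ln (1 + (1 - (norm z)\<^sup>2) * (1 - (norm w)\<^sup>2) / ?d\<^sup>2) / 2 = - ln (?d / ?N)"
    using d N by (simp add: ln_div ln_realpow)
  then show ?thesis
    using assms by (simp add: green_kernel_def log_kernel_def)
qed

text \<open>
  The case \<open>a = 1\<close> gives the decay of the kernel far from its pole; a small \<open>a\<close> makes the logarithmic
  singularity integrable after taking \<open>p\<close>-th powers. It follows from \<open>ln y \<le> y - 1\<close> at
  \<open>y = (1 + x) powr a\<close> and the subadditivity of \<open>x powr a\<close>.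
\<close>
lemma ln_one_plus_le_powr:
  fixes x a :: real
  assumes "0 < a" "a \<le> 1" "0 \<le> x"
  shows "ln (1 + x) \<le> x powr a / a"
proof (cases "x = 0")
  case False
  then have x: "0 < x" using assms by simp
  have "a * ln (1 + x) = ln ((1 + x) powr a)" using x by (simp add: ln_powr)
  also have "\<dots> \<le> (1 + x) powr a - 1" using x by (intro ln_le_minus_one) simp
  also have "(1 + x) powr a = (1 + x) powr (a - 1) + x * (1 + x) powr (a - 1)"
    using x powr_add[of "1 + x" "a - 1" 1] by (simp add: algebra_simps)
  also have "\<dots> \<le> 1 + x * x powr (a - 1)"
    using x assms powr_mono2'[of "a - 1" 1 "1 + x"] powr_mono2'[of "a - 1" x "1 + x"]
    by (intro add_mono mult_left_mono) auto
  also have "1 + x * x powr (a - 1) = 1 + x powr a"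
    using x by (simp add: powr_diff)
  finally show ?thesis using assms by (simp add: field_simps)
qed simp

text \<open>
  A decreasing profile with an integrable singularity at \<open>0\<close> and integrable decay \<open>y^(-3/2)\<close> at
  infinity; it is the derivative of \<open>2 arctan (sqrt y)\<close>. Its formal
  value at \<open>0\<close> is \<open>0\<close>, not \<open>\<infinity>\<close>.
\<close>
definition bump :: "real \<Rightarrow> real" where
  "bump y = y powr (- 1 / 2) / (1 + y)"

lemma bump_nonneg: "0 \<le> y \<Longrightarrow> 0 \<le> bump y"
  by (simp add: bump_def)

lemma measurable_bump [measurable]: "bump \<in> borel_measurable borel"
  unfolding bump_def by measurable

lemma bump_antimono:
  assumes "0 < x" "x \<le> y"
  shows "bump y \<le> bump x"
  unfolding bump_def using assms
  by (intro frac_le powr_mono2') auto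

text \<open>
  Here \<open>d\<close> stands for \<open>\<bar>z - \<zeta>\<bar>\<close> and \<open>k\<close> for the kernel. With \<open>q = s t / m^2\<close> and \<open>y = d / m\<close> the
  argument of the logarithm is \<open>1 + 4 q / y^2\<close>. For \<open>y \<ge> 1/2\<close> one uses \<open>ln (1 + x) \<le> x\<close>, which decays
  faster than needed because \<open>2 p > 3/2\<close>. For \<open>y < 1/2\<close> the radii are so close that \<open>q \<ge> 1/2\<close>,
  whence powers of \<open>q\<close> are harmless constants.
\<close>
lemma kernel_powr_le_bump:
  fixes s t d p k :: real
  defines "m \<equiv> max s t"
  assumes pos: "0 < s" "0 < t" "0 < d" and p: "1 < p"
    and d: "\<bar>s - t\<bar> \<le> d" and k: "0 \<le> k" "k \<le> ln (1 + 4 * s * t / d\<^sup>2) / 2"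
  shows "k powr p \<le> (3 * 8 powr p + 4 * (4 * p) powr p) * (s * t / m\<^sup>2) powr p * bump (d / m)"
proof -
  define q where "q = s * t / m\<^sup>2"
  define y where "y = d / m"
  have m: "0 < m" using pos by (simp add: m_def)
  have q: "0 < q" and y: "0 < y" using pos m by (simp_all add: q_def y_def)
  have X: "4 * s * t / d\<^sup>2 = 4 * q / y\<^sup>2"
    using m pos by (simp add: q_def y_def field_simps)
  have bump: "0 \<le> q powr p * bump y" using y by (simp add: bump_nonneg)
  have "k powr p \<le> 3 * 8 powr p * (q powr p * bump y)
      \<or> k powr p \<le> 4 * (4 * p) powr p * (q powr p * bump y)"
  proof (cases "1 / 2 \<le> y")
    case True
    have "k \<le> 2 * q / y\<^sup>2"
      using k X ln_add_one_self_le_self[of "4 * q / y\<^sup>2"] q by simp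
    then have "k powr p \<le> (2 * q / y\<^sup>2) powr p"
      using k p by (intro powr_mono2) auto
    also have "\<dots> = 2 powr p * q powr p * (y powr (3 / 2 - 2 * p) * y powr (- 3 / 2))"
      using q y by (simp add: powr_divide powr_mult powr_powr powr_minus field_simps
        flip: powr_add powr_numeral)
    also have "y powr (3 / 2 - 2 * p) * y powr (- 3 / 2) \<le> 4 powr p * (3 * bump y)"
    proof (intro mult_mono)
      have "y powr (3 / 2 - 2 * p) \<le> (1 / 2) powr (3 / 2 - 2 * p)"
        using True p by (intro powr_mono2') auto
      also have "\<dots> = 2 powr (2 * p - 3 / 2)"
        by (simp add: powr_divide powr_minus[symmetric] flip: powr_minus_divide)
      also have "\<dots> \<le> 2 powr (2 * p)" by (intro powr_mono) auto
      also have "\<dots> = 4 powr p" by (simp flip: powr_powr)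
      finally show "y powr (3 / 2 - 2 * p) \<le> 4 powr p" .
      have "y powr (- 3 / 2) = y powr (- 1 / 2) * (1 / y)"
        using y powr_add[of y "- 1 / 2" "- 1"] by (simp add: powr_minus_divide)
      also have "\<dots> \<le> y powr (- 1 / 2) * (3 / (1 + y))"
        using True by (intro mult_left_mono) (auto simp: field_simps)
      finally show "y powr (- 3 / 2) \<le> 3 * bump y" by (simp add: bump_def mult.commute)
    qed auto
    finally have "k powr p \<le> 2 powr p * q powr p * (4 powr p * (3 * bump y))"
      by (simp add: mult_left_mono)
    also have "2 powr p * q powr p * (4 powr p * (3 * bump y))
        = 3 * (2 powr p * 4 powr p) * (q powr p * bump y)" by simp
    also have "(2::real) powr p * 4 powr p = 8 powr p" by (simp flip: powr_mult)
    finally show ?thesis by simp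
  next
    case False
    have "d < m / 2" using False m by (simp add: y_def field_simps)
    then have "max s t / 2 \<le> min s t"
      using d by (cases "s \<le> t") (auto simp: m_def max_def min_def)
    moreover have "s * t = max s t * min s t" by (simp add: max_def min_def)
    ultimately have "m * (m / 2) \<le> s * t"
      unfolding m_def using m by (metis m_def mult_left_mono less_imp_le)
    then have q2: "1 / 2 \<le> q" using m by (simp add: q_def field_simps power2_eq_square)
    have "min s t \<le> max s t" by simp
    then have "s * t \<le> m * m"
      using pos by (simp add: m_def mult_mono)
    then have q1: "q \<le> 1" using m by (simp add: q_def power2_eq_square)
    \<comment> \<open>With this exponent the \<open>p\<close>-th power of the bound is of order \<open>y powr (- 1 / 2)\<close>.\<close>
    define a where "a = 1 / (4 * p)"
    have a: "0 < a" "a \<le> 1" "a * p = 1 / 4" using p by (simp_all add: a_def)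
    have "k \<le> (4 * q / y\<^sup>2) powr a / a / 2"
      using k X ln_one_plus_le_powr[OF a(1,2), of "4 * q / y\<^sup>2"] q by simp
    also have "\<dots> = (2 * p) * (4 * q / y\<^sup>2) powr a" using p by (simp add: a_def)
    finally have "k powr p \<le> ((2 * p) * (4 * q / y\<^sup>2) powr a) powr p"
      using k p by (intro powr_mono2) auto
    also have "\<dots> = (2 * p) powr p * ((4 * q) powr (1 / 4) * y powr (- 1 / 2))"
    proof -
      have "(y\<^sup>2) powr (1 / 4) = (y powr 2) powr (1 / 4)" using y by simp
      also have "\<dots> = y powr (1 / 2)" unfolding powr_powr by simp
      finally have "(y\<^sup>2) powr (1 / 4) = y powr (1 / 2)" .
      moreover have "(4 * q / y\<^sup>2) powr (1 / 4) = (4 * q) powr (1 / 4) / (y\<^sup>2) powr (1 / 4)"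
        by (simp only: powr_divide)
      moreover have "y powr (- 1 / 2) = 1 / y powr (1 / 2)"
        using powr_minus_divide[of y "1 / 2"] by simp
      ultimately have "(4 * q / y\<^sup>2) powr (1 / 4) = (4 * q) powr (1 / 4) * y powr (- 1 / 2)"
        by (simp only: times_divide_eq_right mult_1_right)
      moreover have "((2 * p) * (4 * q / y\<^sup>2) powr a) powr p
          = (2 * p) powr p * (4 * q / y\<^sup>2) powr (a * p)"
        using p by (simp add: powr_mult powr_powr)
      ultimately show ?thesis by (simp only: a(3))
    qed
    also have "(4 * q) powr (1 / 4) * y powr (- 1 / 2) \<le> (2 * (2 * q) powr p) * (2 * bump y)"
    proof (intro mult_mono)
      have "(4 * q) powr (1 / 4) \<le> 4 powr (1 / 4)" using q q1 by (intro powr_mono2) auto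
      also have "\<dots> \<le> 4 powr (1 / 2)" by (intro powr_mono) auto
      also have "\<dots> = 2 * 1" by (simp add: powr_half_sqrt)
      also have "\<dots> \<le> 2 * (2 * q) powr p"
        using q2 p by (intro mult_left_mono ge_one_powr_ge_zero) auto
      finally show "(4 * q) powr (1 / 4) \<le> 2 * (2 * q) powr p" .
      have "y powr (- 1 / 2) * 1 \<le> y powr (- 1 / 2) * (2 / (1 + y))"
        using False y by (intro mult_left_mono) auto
      then show "y powr (- 1 / 2) \<le> 2 * bump y" by (simp add: bump_def mult.commute)
    qed auto
    finally have "k powr p \<le> (2 * p) powr p * ((2 * (2 * q) powr p) * (2 * bump y))"
      by (simp add: mult_left_mono)
    also have "\<dots> = 4 * ((2 * p) powr p * 2 powr p) * (q powr p * bump y)"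
      using q by (simp add: powr_mult)
    also have "(2 * p) powr p * 2 powr p = (4 * p) powr p"
      using p by (simp flip: powr_mult)
    finally show ?thesis by simp
  qed
  moreover have "0 \<le> 3 * 8 powr p * (q powr p * bump y)" "0 \<le> 4 * (4 * p) powr p * (q powr p * bump y)"
    using bump p by simp_all
  ultimately have "k powr p \<le> 3 * 8 powr p * (q powr p * bump y) + 4 * (4 * p) powr p * (q powr p * bump y)"
    by linarith
  then show ?thesis unfolding q_def y_def by (simp add: algebra_simps)
qed

lemma bump_integral_finite: "(\<integral>\<^sup>+ y. ennreal (bump \<bar>y\<bar>) \<partial>lborel) < \<infinity>"
proof -
  have deriv: "((\<lambda>y. 2 * arctan (sqrt y)) has_real_derivative bump y) (at y)" if "0 < y" for y
  proof -
    have "y powr (- 1 / 2) = inverse (sqrt y)"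
      using that powr_minus[of y "1/2"] by (simp add: powr_half_sqrt)
    then have "bump y = inverse (sqrt y) / (1 + y)" by (simp only: bump_def)
    moreover have "2 * (inverse (1 + (sqrt y)\<^sup>2) * (inverse (sqrt y) / 2)) = inverse (sqrt y) / (1 + y)"
      using that by (simp add: inverse_eq_divide)
    moreover have "((\<lambda>y. 2 * arctan (sqrt y)) has_real_derivative
        2 * (inverse (1 + (sqrt y)\<^sup>2) * (inverse (sqrt y) / 2))) (at y)"
      using that by (intro DERIV_cmult DERIV_chain2[OF DERIV_arctan] DERIV_real_sqrt)
    ultimately show ?thesis by (simp only:)
  qed
  have int: "set_integrable lborel (einterval 0 \<infinity>) bump"
  proof (rule interval_integral_FTC_nonneg(1))
    show "DERIV (\<lambda>y. 2 * arctan (sqrt y)) x :> bump x" if "0 < ereal x" for x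
      using that by (intro deriv) (simp add: zero_ereal_def)
    show "isCont bump x" if "0 < ereal x" for x
      using that unfolding bump_def by (intro continuous_intros) (auto simp: zero_ereal_def)
    show "AE x in lborel. 0 < ereal x \<longrightarrow> ereal x < \<infinity> \<longrightarrow> 0 \<le> bump x"
      by (auto simp: bump_nonneg zero_ereal_def)
    have "((\<lambda>y. 2 * arctan (sqrt y)) \<longlongrightarrow> 2 * arctan (sqrt 0)) (at_right 0)"
      by (intro tendsto_intros)
    then show "(((\<lambda>y. 2 * arctan (sqrt y)) \<circ> real_of_ereal) \<longlongrightarrow> 0) (at_right 0)"
      unfolding zero_ereal_def ereal_tendsto_simps by simp
    have "((\<lambda>y. 2 * arctan (sqrt y)) \<longlongrightarrow> 2 * (pi / 2)) at_top"
      by (intro tendsto_intros filterlim_compose[OF tendsto_arctan_at_top sqrt_at_top])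
    then show "(((\<lambda>y. 2 * arctan (sqrt y)) \<circ> real_of_ereal) \<longlongrightarrow> 2 * (pi / 2)) (at_left \<infinity>)"
      unfolding ereal_tendsto_simps .
  qed simp
  define f where "f y = ennreal (bump y) * indicator {0<..} y" for y
  have [measurable]: "f \<in> borel_measurable borel" unfolding f_def by measurable
  have "(\<integral>\<^sup>+ y. f y \<partial>lborel) = (\<integral>\<^sup>+ y. ennreal (indicator (einterval 0 \<infinity>) y *\<^sub>R bump y) \<partial>lborel)"
    by (intro nn_integral_cong) (auto simp: f_def indicator_def einterval_def zero_ereal_def)
  also have "\<dots> < \<infinity>"
    using int unfolding set_integrable_def real_integrable_def by (auto simp: top.not_eq_extremum)
  finally have fin: "(\<integral>\<^sup>+ y. f y \<partial>lborel) < \<infinity>" .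
  have "(\<integral>\<^sup>+ y. ennreal (bump \<bar>y\<bar>) \<partial>lborel) \<le> (\<integral>\<^sup>+ y. f y + f (- y) \<partial>lborel)"
    by (intro nn_integral_mono) (auto simp: f_def bump_def indicator_def abs_if)
  also have "\<dots> = (\<integral>\<^sup>+ y. f y \<partial>lborel) + (\<integral>\<^sup>+ y. f (- y) \<partial>lborel)"
    by (intro nn_integral_add) measurable
  also have "(\<integral>\<^sup>+ y. f (- y) \<partial>lborel) = (\<integral>\<^sup>+ y. f y \<partial>lborel)"
    by (subst (2) nn_integral_real_affine[where c = "-1" and t = 0]) auto
  also have "(\<integral>\<^sup>+ y. f y \<partial>lborel) + (\<integral>\<^sup>+ y. f y \<partial>lborel) < \<infinity>"
    using fin by (simp add: ennreal_add_less_top)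
  finally show ?thesis .
qed

lemma norm_cis_diff: "norm (cis a - cis b) = 2 * \<bar>sin ((a - b) / 2)\<bar>"
proof -
  have "(norm (cis a - cis b))\<^sup>2 = (cos a - cos b)\<^sup>2 + (sin a - sin b)\<^sup>2"
    by (simp add: cmod_power2)
  also have "\<dots> = 2 - 2 * cos (a - b)"
    using sin_cos_squared_add[of a] sin_cos_squared_add[of b]
    unfolding power2_diff cos_diff by (simp add: algebra_simps)
  also have "cos (a - b) = 1 - 2 * (sin ((a - b) / 2))\<^sup>2"
    using cos_double_sin[of "(a - b) / 2"] by (simp only: nonzero_mult_div_cancel_left times_divide_eq_right)
  also have "2 - 2 * (1 - 2 * (sin ((a - b) / 2))\<^sup>2) = (2 * \<bar>sin ((a - b) / 2)\<bar>)\<^sup>2"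
    by (simp add: power_mult_distrib)
  finally show ?thesis by (rule power2_eq_imp_eq) auto
qed

text \<open>
  A weak form of Jordan's inequality: since \<open>x \<le> pi / 2 < 2\<close>, the cubic Taylor term \<open>x^3 / 6\<close> is at
  most \<open>2 x / 3\<close>.
\<close>
lemma sin_ge_third:
  fixes x :: real
  assumes "0 \<le> x" "x \<le> pi / 2"
  shows "x / 3 \<le> sin x"
proof -
  have "\<bar>sin x - (\<Sum>m<3. sin_coeff m * x ^ m)\<bar> \<le> inverse (fact 3) * \<bar>x\<bar> ^ 3"
    by (rule Maclaurin_sin_bound)
  then have "\<bar>sin x - x\<bar> \<le> x ^ 3 / 6"
    using assms by (simp add: sin_coeff_def eval_nat_numeral lessThan_Suc)
  then have "x - x ^ 3 / 6 \<le> sin x" by linarith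
  moreover have "x * x \<le> 2 * 2" using assms pi_less_4 by (intro mult_mono) auto
  then have "x * (x * x) \<le> x * 4" using assms by (intro mult_left_mono) auto
  ultimately show ?thesis by (simp add: power3_eq_cube)
qed

text \<open>
  Chord length against arc length. Working with angles in \<open>[0, 2 pi]\<close> and a shift \<open>j\<close> by a full turn
  avoids periodic integrals: later, all three shifts are integrated over the whole line.
\<close>
lemma norm_cis_diff_ge:
  assumes "a \<in> {0..2 * pi}" "b \<in> {0..2 * pi}"
  obtains j where "j \<in> {- 2 * pi, 0, 2 * pi}" "\<bar>a - b + j\<bar> / 3 \<le> norm (cis a - cis b)"
proof -
  obtain j where j: "j \<in> {- 2 * pi, 0, 2 * pi}" "\<bar>a - b + j\<bar> \<le> pi"
  proof -
    consider "a - b < - pi" | "\<bar>a - b\<bar> \<le> pi" | "pi < a - b" by linarith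
    then show ?thesis
      using that[of 0] that[of "2 * pi"] that[of "- 2 * pi"] assms by cases auto
  qed
  have "cis a - cis b = cis (a + j) - cis b"
    using j(1) cos_periodic[of "a - 2 * pi"] sin_periodic[of "a - 2 * pi"]
    by (auto simp: complex_eq_iff)
  then have "norm (cis a - cis b) = 2 * \<bar>sin ((a - b + j) / 2)\<bar>"
    using norm_cis_diff[of "a + j" b] by (simp add: algebra_simps)
  also have "\<bar>sin ((a - b + j) / 2)\<bar> = \<bar>sin \<bar>(a - b + j) / 2\<bar>\<bar>" by (simp add: abs_if)
  finally show ?thesis
    using that[OF j(1)] sin_ge_third[of "\<bar>(a - b + j) / 2\<bar>"] j(2) by simp
qed

lemma measurable_green_kernel [measurable (raw)]:
  assumes [measurable]: "f \<in> borel_measurable M" "g \<in> borel_measurable M"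
  shows "(\<lambda>x. green_kernel (f x) (g x)) \<in> borel_measurable M"
proof -
  have [measurable]: "cnj \<in> borel_measurable borel"
    by (intro borel_measurable_continuous_onI continuous_intros)
  have "{x \<in> space M. f x = g x} = (\<lambda>x. f x - g x) -` {0} \<inter> space M" by auto
  also have "\<dots> \<in> sets M" by measurable
  finally have [measurable]: "{x \<in> space M. f x = g x} \<in> sets M" .
  show ?thesis unfolding green_kernel_def log_kernel_def by measurable
qed

text \<open>
  The distance \<open>\<bar>z - \<zeta>\<bar>\<close> dominates both the radial distance \<open>\<bar>s - t\<bar>\<close> and, up to the factor \<open>1/12\<close>,
  the angular distance modulo \<open>2 pi\<close>. The sum over \<open>j\<close> covers the unknown multiple of \<open>2 pi\<close>. The excluded
  angles are those of \<open>\<zeta>\<close> itself, where a bump is evaluated at \<open>0\<close> and its formal value bounds nothing.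
\<close>
lemma green_kernel_powr_le_bump:
  fixes r p :: real and \<zeta> :: complex
  defines "s \<equiv> 1 - norm \<zeta>" and "t \<equiv> 1 - r"
  defines "m \<equiv> max s t"
  assumes p: "1 < p" and r: "1 / 2 \<le> r" "r < 1" and \<zeta>: "norm \<zeta> < 1"
    and \<theta>: "\<theta> \<in> {0..2 * pi}" "\<theta> - Arg2pi \<zeta> \<notin> {- 2 * pi, 0, 2 * pi}"
  shows "ennreal_powr (green_kernel (of_real r * cis \<theta>) \<zeta>) p
    \<le> ennreal ((3 * 8 powr p + 4 * (4 * p) powr p) * (s * t / m\<^sup>2) powr p) *
      (\<Sum>j\<in>{- 2 * pi, 0, 2 * pi}. ennreal (bump \<bar>(\<theta> - Arg2pi \<zeta> + j) / (12 * m)\<bar>))"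
    (is "?L \<le> ennreal ?C * _")
proof -
  define z where "z = of_real r * cis \<theta>"
  define \<phi> where "\<phi> = Arg2pi \<zeta>"
  have \<zeta>_polar: "\<zeta> = of_real (norm \<zeta>) * cis \<phi>"
    unfolding \<phi>_def cis_conv_exp using Arg2pi_eq[of \<zeta>] by (simp add: mult.commute)
  have nz: "norm z = r" using r by (simp add: z_def norm_mult)
  have s: "0 < s" "s \<le> 1" and t: "0 < t" "t \<le> 1" and m: "0 < m"
    using r \<zeta> by (auto simp: s_def t_def m_def)
  define d where "d = norm (z - \<zeta>)"
  have radial: "\<bar>s - t\<bar> \<le> d"
    using norm_triangle_ineq3[of z \<zeta>] nz by (simp add: d_def s_def t_def)
  obtain j where j: "j \<in> {- 2 * pi, 0, 2 * pi}" "\<bar>\<theta> - \<phi> + j\<bar> / 3 \<le> norm (cis \<theta> - cis \<phi>)"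
  proof (rule norm_cis_diff_ge[of \<theta> \<phi>])
    show "\<phi> \<in> {0..2 * pi}" using Arg2pi[of \<zeta>] by (simp add: \<phi>_def)
  qed (use \<theta>(1) in \<open>assumption\<close>)
  have nonzero: "\<theta> - \<phi> + j \<noteq> 0" using j(1) \<theta>(2) by (auto simp: \<phi>_def)
  have "of_real (norm \<zeta> - r) * cis \<phi> = \<zeta> - of_real r * cis \<phi>"
    by (simp add: left_diff_distrib \<zeta>_polar[symmetric])
  then have "of_real r * (cis \<theta> - cis \<phi>) = z - \<zeta> + of_real (norm \<zeta> - r) * cis \<phi>"
    by (simp add: z_def right_diff_distrib)
  then have "r * norm (cis \<theta> - cis \<phi>) = norm (z - \<zeta> + of_real (norm \<zeta> - r) * cis \<phi>)"
    using r norm_mult[of "of_real r" "cis \<theta> - cis \<phi>"] by simp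
  also have "\<dots> \<le> d + \<bar>norm \<zeta> - r\<bar>"
    using norm_triangle_ineq[of "z - \<zeta>" "of_real (norm \<zeta> - r) * cis \<phi>"]
    by (simp add: d_def norm_mult del: of_real_diff)
  also have "\<dots> \<le> 2 * d" using radial by (simp add: s_def t_def)
  finally have "1 / 2 * norm (cis \<theta> - cis \<phi>) \<le> 2 * d"
    using mult_right_mono[OF r(1), of "norm (cis \<theta> - cis \<phi>)"] by simp
  then have angular: "\<bar>\<theta> - \<phi> + j\<bar> / 12 \<le> d" using j(2) by simp
  moreover have "0 < \<bar>\<theta> - \<phi> + j\<bar> / 12" using nonzero by simp
  ultimately have d: "0 < d" by linarith
  then have "z \<noteq> \<zeta>" by (auto simp: d_def)
  define k where "k = ln (1 + (1 - r\<^sup>2) * (1 - (norm \<zeta>)\<^sup>2) / d\<^sup>2) / 2"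
  have K: "green_kernel z \<zeta> = ennreal k"
    using green_kernel_eq_ln[of z \<zeta>] nz r \<zeta> \<open>z \<noteq> \<zeta>\<close> by (simp add: k_def d_def)
  have "1 - r\<^sup>2 \<ge> 0" "1 - (norm \<zeta>)\<^sup>2 \<ge> 0"
    using r \<zeta> by (auto simp: power_le_one_iff)
  then have k0: "0 \<le> k" by (simp add: k_def)
  have "1 - r\<^sup>2 = (1 + r) * t" "1 - (norm \<zeta>)\<^sup>2 = (1 + norm \<zeta>) * s"
    by (simp_all add: t_def s_def algebra_simps power2_eq_square)
  then have "(1 - r\<^sup>2) * (1 - (norm \<zeta>)\<^sup>2) \<le> (2 * t) * (2 * s)"
    using r \<zeta> s t by (simp only:) (intro mult_mono, auto)
  then have "k \<le> ln (1 + 4 * s * t / d\<^sup>2) / 2"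
    unfolding k_def using d \<open>1 - r\<^sup>2 \<ge> 0\<close> \<open>1 - (norm \<zeta>)\<^sup>2 \<ge> 0\<close>
    by (intro divide_right_mono ln_mono add_left_mono) (auto intro!: add_pos_nonneg simp: mult_ac)
  then have "k powr p \<le> ?C * bump (d / m)"
    using kernel_powr_le_bump[of s t d p k] s t d p radial k0 by (simp add: m_def)
  also have "\<dots> \<le> ?C * bump \<bar>(\<theta> - \<phi> + j) / (12 * m)\<bar>"
    using m d p nonzero angular
    by (intro mult_left_mono bump_antimono) (auto simp: abs_mult field_simps)
  finally have "?L \<le> ennreal (?C * bump \<bar>(\<theta> - \<phi> + j) / (12 * m)\<bar>)"
    using k0 by (simp add: K ennreal_leI flip: z_def)
  also have "\<dots> = ennreal ?C * ennreal (bump \<bar>(\<theta> - \<phi> + j) / (12 * m)\<bar>)"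
    by (intro ennreal_mult) (auto simp: bump_nonneg)
  also have "ennreal (bump \<bar>(\<theta> - \<phi> + j) / (12 * m)\<bar>)
      \<le> (\<Sum>j\<in>{- 2 * pi, 0, 2 * pi}. ennreal (bump \<bar>(\<theta> - \<phi> + j) / (12 * m)\<bar>))"
    using j(1) by (intro member_le_sum) auto
  finally show ?thesis by (simp add: mult_left_mono \<phi>_def)
qed

text \<open>
  Up to a constant factor, a bound for the \<open>p\<close>-th mean, over the circle at distance \<open>t\<close> from the unit circle, of the Green
  kernel with pole at distance \<open>s\<close> from it.
\<close>
definition radial_weight :: "real \<Rightarrow> real \<Rightarrow> real \<Rightarrow> real" where
  "radial_weight p s t = s * t / (max s t)\<^sup>2 * max s t powr (1 / p)"

text \<open>
  After the substitution \<open>y = (\<theta> - arg \<zeta> + j) / (12 m)\<close> the bound by bumps integrates to a constant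
  times \<open>m (s t / m^2)^p\<close>, which is the \<open>p\<close>-th power of the radial weight.
\<close>
lemma green_kernel_mean_bound:
  assumes p: "1 < p"
  obtains C where "0 < C"
    "\<And>r \<zeta>. 1 / 2 \<le> r \<Longrightarrow> r < 1 \<Longrightarrow> norm \<zeta> < 1 \<Longrightarrow>
      (\<integral>\<^sup>+ \<theta>\<in>{0..2 * pi}. ennreal_powr (green_kernel (of_real r * cis \<theta>) \<zeta>) p \<partial>lborel)
      \<le> ennreal ((C * radial_weight p (1 - norm \<zeta>) (1 - r)) powr p)"
proof -
  define J where "J = enn2real (\<integral>\<^sup>+ y. ennreal (bump \<bar>y\<bar>) \<partial>lborel)"
  have J: "(\<integral>\<^sup>+ y. ennreal (bump \<bar>y\<bar>) \<partial>lborel) = ennreal J" "0 \<le> J"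
    using bump_integral_finite by (simp_all add: J_def)
  define A where "A = 3 * 8 powr p + 4 * (4 * p) powr p"
  have A: "0 < A" using p by (simp add: A_def add_pos_pos)
  have AJ: "0 \<le> 36 * A * J" using A J by simp
  define C where "C = (36 * A * J + 1) powr (1 / p)"
  have Cp: "C powr p = 36 * A * J + 1"
    using p AJ by (simp add: C_def powr_powr)
  have C: "0 < C" using AJ by (simp add: C_def)
  have "(\<integral>\<^sup>+ \<theta>\<in>{0..2 * pi}. ennreal_powr (green_kernel (of_real r * cis \<theta>) \<zeta>) p \<partial>lborel)
      \<le> ennreal ((C * radial_weight p s t) powr p)"
    if r: "1 / 2 \<le> r" "r < 1" and \<zeta>: "norm \<zeta> < 1"
      and s: "s = 1 - norm \<zeta>" and t: "t = 1 - r" and m: "m = max s t" for r \<zeta> s t m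
  proof -
    have pos: "0 < s" "0 < t" "0 < m" using r \<zeta> s t m by auto
    define q where "q = (s * t / m\<^sup>2) powr p"
    have q: "0 \<le> q" by (simp add: q_def)
    have null: "AE \<theta> in lborel. \<theta> \<notin> (\<lambda>j. Arg2pi \<zeta> + j) ` {- 2 * pi, 0, 2 * pi}"
      by (intro AE_not_in finite_imp_null_set_lborel) auto
    have "(\<integral>\<^sup>+ \<theta>\<in>{0..2 * pi}. ennreal_powr (green_kernel (of_real r * cis \<theta>) \<zeta>) p \<partial>lborel)
      \<le> (\<integral>\<^sup>+ \<theta>. ennreal (A * q) * (\<Sum>j\<in>{- 2 * pi, 0, 2 * pi}.
          ennreal (bump \<bar>(\<theta> - Arg2pi \<zeta> + j) / (12 * m)\<bar>)) \<partial>lborel)"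
    proof (rule nn_integral_mono_AE, rule eventually_mono[OF null])
      fix \<theta> assume "\<theta> \<notin> (\<lambda>j. Arg2pi \<zeta> + j) ` {- 2 * pi, 0, 2 * pi}"
      then have \<theta>: "\<theta> - Arg2pi \<zeta> \<notin> {- 2 * pi, 0, 2 * pi}"
        by (metis add_diff_cancel_left' image_eqI diff_add_cancel add.commute)
      show "ennreal_powr (green_kernel (of_real r * cis \<theta>) \<zeta>) p * indicator {0..2 * pi} \<theta>
        \<le> ennreal (A * q) * (\<Sum>j\<in>{- 2 * pi, 0, 2 * pi}.
            ennreal (bump \<bar>(\<theta> - Arg2pi \<zeta> + j) / (12 * m)\<bar>))"
      proof (cases "\<theta> \<in> {0..2 * pi}")
        case True
        from green_kernel_powr_le_bump[OF p r \<zeta> True \<theta>] True show ?thesis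
          unfolding A_def q_def s t m by (simp only: indicator_simps mult_1_right)
      qed simp
    qed
    also have "\<dots> = ennreal (A * q) * (\<Sum>j\<in>{- 2 * pi, 0, 2 * pi}.
          (\<integral>\<^sup>+ \<theta>. ennreal (bump \<bar>(\<theta> - Arg2pi \<zeta> + j) / (12 * m)\<bar>) \<partial>lborel))"
      by (simp add: nn_integral_cmult nn_integral_sum del: sum.insert)
    also have "(\<lambda>j. \<integral>\<^sup>+ \<theta>. ennreal (bump \<bar>(\<theta> - Arg2pi \<zeta> + j) / (12 * m)\<bar>) \<partial>lborel)
        = (\<lambda>j. ennreal (12 * m * J))"
    proof
      fix j
      have "(\<integral>\<^sup>+ \<theta>. ennreal (bump \<bar>(\<theta> - Arg2pi \<zeta> + j) / (12 * m)\<bar>) \<partial>lborel)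
        = ennreal \<bar>12 * m\<bar> * (\<integral>\<^sup>+ y. ennreal (bump
            \<bar>((Arg2pi \<zeta> - j + 12 * m * y) - Arg2pi \<zeta> + j) / (12 * m)\<bar>) \<partial>lborel)"
        using pos by (intro nn_integral_real_affine) auto
      also have "\<dots> = ennreal (12 * m) * ennreal J"
        using pos J by simp
      finally show "(\<integral>\<^sup>+ \<theta>. ennreal (bump \<bar>(\<theta> - Arg2pi \<zeta> + j) / (12 * m)\<bar>) \<partial>lborel)
        = ennreal (12 * m * J)" using pos J by (simp flip: ennreal_mult)
    qed
    also have "(\<Sum>j\<in>{- 2 * pi, 0, 2 * pi}. ennreal (12 * m * J)) = ennreal (36 * m * J)"
      using pos J ennreal_mult[of 3 "12 * m * J"] by (simp add: mult.assoc)
    also have "ennreal (A * q) * ennreal (36 * m * J) = ennreal (36 * A * J * q * m)"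
      using A q pos J by (simp add: mult_ac flip: ennreal_mult)
    also have "\<dots> \<le> ennreal ((36 * A * J + 1) * q * m)"
      using A q pos J by (intro ennreal_leI mult_right_mono) auto
    also have "(36 * A * J + 1) * q * m = (C * radial_weight p s t) powr p"
    proof -
      have "(m powr (1 / p)) powr p = m" using pos p by (simp add: powr_powr)
      then show ?thesis by (simp only: radial_weight_def powr_mult q_def Cp mult.assoc flip: m)
    qed
    finally show ?thesis .
  qed
  then show ?thesis using that[OF C] by blast
qed

section \<open>Summation over dyadic layers\<close>

lemma dyadic_position:
  fixes x y :: real
  assumes "0 < x" "x \<le> y"
  obtains k :: nat where "2 ^ k * x \<le> y" "y < 2 ^ Suc k * x"
proof -
  obtain N where N: "y / x < 2 ^ N" using real_arch_pow[of 2 "y / x"] by auto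
  define n where "n = (LEAST n. y < 2 ^ n * x)"
  have "y < 2 ^ N * x" using N assms by (simp add: field_simps)
  then have n: "y < 2 ^ n * x" unfolding n_def by (rule LeastI)
  then have "n \<noteq> 0" using assms by (intro notI) simp
  then obtain k where k: "n = Suc k" by (cases n) auto
  have "2 ^ k * x \<le> y"
    using not_less_Least[of k "\<lambda>n. y < 2 ^ n * x"] k unfolding n_def by (auto simp: not_less)
  then show ?thesis using that n k by force
qed

text \<open>
  Layer by layer, \<open>f\<close> is at most \<open>a k\<close> on a set of mass at most \<open>b k\<close>, and the products form a
  geometric series. The sets \<open>E k\<close> may overlap.
\<close>
lemma nn_integral_le_geometric_layers:
  fixes f :: "'a \<Rightarrow> real" and a b :: "nat \<Rightarrow> real" and c q :: real and E :: "nat \<Rightarrow> 'a set"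
  assumes [measurable]: "\<And>k. E k \<in> sets M"
    and nonneg: "0 \<le> c" "\<And>k. 0 \<le> a k"
    and cover: "\<And>x. x \<in> space M \<Longrightarrow> f x \<noteq> 0 \<Longrightarrow> \<exists>k. x \<in> E k \<and> f x \<le> a k"
    and mass: "\<And>k. emeasure M (E k) \<le> ennreal (b k)"
    and geometric: "\<And>k. a k * b k = c * q ^ k"
    and q: "0 < q" "q < 1"
  shows "(\<integral>\<^sup>+ x. ennreal (f x) \<partial>M) \<le> ennreal (c / (1 - q))"
proof -
  have "(\<integral>\<^sup>+ x. ennreal (f x) \<partial>M) \<le> (\<integral>\<^sup>+ x. (\<Sum>k. ennreal (a k) * indicator (E k) x) \<partial>M)"
  proof (rule nn_integral_mono)
    fix x assume x: "x \<in> space M"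
    show "ennreal (f x) \<le> (\<Sum>k. ennreal (a k) * indicator (E k) x)"
    proof (cases "f x = 0")
      case False
      then obtain k where k: "x \<in> E k" "f x \<le> a k" using cover x by blast
      then have "ennreal (f x) \<le> ennreal (a k) * indicator (E k) x"
        by (simp add: ennreal_leI)
      also have "\<dots> \<le> (\<Sum>k. ennreal (a k) * indicator (E k) x)"
      proof -
        define h where "h = (\<lambda>k. ennreal (a k) * indicator (E k) x)"
        have "h k \<le> suminf h" using sum_le_suminf[of h "{k}"] by simp
        then show ?thesis by (simp only: h_def)
      qed
      finally show ?thesis .
    qed simp
  qed
  also have "\<dots> = (\<Sum>k. ennreal (a k) * emeasure M (E k))"
    by (simp add: nn_integral_suminf nn_integral_cmult_indicator)
  also have "\<dots> \<le> (\<Sum>k. ennreal (a k) * ennreal (b k))"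
    by (intro suminf_le mult_left_mono mass) auto
  also have "\<dots> = (\<Sum>k. ennreal (c * q ^ k))"
    by (simp add: geometric nonneg flip: ennreal_mult')
  also have "\<dots> = ennreal (c / (1 - q))"
    using q nonneg sums_mult[OF geometric_sums[of q], of c]
    by (intro suminf_ennreal_eq) auto
  finally show ?thesis .
qed

text \<open>
  The weight is split at \<open>\<sigma> = t\<close>: it is \<open>f1 = t \<sigma>^(1/p-1)\<close> above and \<open>f2 = \<sigma> t^(1/p-1)\<close> below. On the
  layers \<open>\<sigma> ~ 2^k t\<close> the products of weight and mass are \<open>B t^(-\<alpha>) 2^(-k(1+\<alpha>))\<close>; on the layers
  \<open>\<sigma> ~ 2^(-k) t\<close> they are \<open>B 2^\<beta> t^(-\<alpha>) 2^(-k(1-\<beta>))\<close> with \<open>\<beta> = \<alpha> + 1/p < 1\<close>.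
\<close>
lemma nn_integral_radial_weight_le:
  fixes \<sigma> :: "'a \<Rightarrow> real" and \<alpha> p B :: real
  assumes [measurable]: "\<sigma> \<in> borel_measurable M"
    and \<sigma>: "\<And>x. x \<in> space M \<Longrightarrow> 0 < \<sigma> x"
    and p: "1 < p" and \<alpha>: "0 \<le> \<alpha>" and \<alpha>p: "\<alpha> + 1 / p < 1" and B: "0 \<le> B"
    and mass: "\<And>\<tau>. 0 < \<tau> \<Longrightarrow>
      emeasure M {x \<in> space M. \<tau> \<le> \<sigma> x} \<le> ennreal (B * \<tau> powr (- \<alpha> - 1 / p))"
  obtains C where "0 < C"
    "\<And>t. 0 < t \<Longrightarrow>
      (\<integral>\<^sup>+ x. ennreal (radial_weight p (\<sigma> x) t) \<partial>M) \<le> ennreal (C * t powr (- \<alpha>))"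
proof -
  define \<beta> where "\<beta> = \<alpha> + 1 / p"
  define C1 where "C1 = B / (1 - 2 powr (- 1 - \<alpha>))"
  define C2 where "C2 = B * 2 powr \<beta> / (1 - 2 powr (\<beta> - 1))"
  have lt1: "2 powr (- 1 - \<alpha>) < (1::real)" "2 powr (\<beta> - 1) < (1::real)"
    using \<alpha> \<alpha>p by (auto simp: \<beta>_def intro: powr_less_one)
  have C12: "0 \<le> C1" "0 \<le> C2" using B lt1 by (auto simp: C1_def C2_def)
  have "(\<integral>\<^sup>+ x. ennreal (radial_weight p (\<sigma> x) t) \<partial>M) \<le> ennreal ((C1 + C2) * t powr (- \<alpha>))" if t: "0 < t" for t
  proof -
    define f1 where "f1 x = (if t \<le> \<sigma> x then t * \<sigma> x powr (1 / p - 1) else 0)" for x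
    define f2 where "f2 x = (if \<sigma> x < t then \<sigma> x * t powr (1 / p - 1) else 0)" for x
    have [measurable]: "f1 \<in> borel_measurable M" "f2 \<in> borel_measurable M"
      unfolding f1_def f2_def by measurable
    have split: "radial_weight p (\<sigma> x) t = f1 x + f2 x"
      if "x \<in> space M" for x
      using \<sigma>[OF that] t
      by (cases "t \<le> \<sigma> x") (auto simp: radial_weight_def f1_def f2_def max_def powr_diff power2_eq_square)
    have nonneg: "0 \<le> f1 x" "0 \<le> f2 x" if "x \<in> space M" for x
      using \<sigma>[OF that] t by (auto simp: f1_def f2_def)
    have "(\<integral>\<^sup>+ x. ennreal (f1 x) \<partial>M) \<le> ennreal (B * t powr (- \<alpha>) / (1 - 2 powr (- 1 - \<alpha>)))"
    proof (rule nn_integral_le_geometric_layers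
        [where a = "\<lambda>k. t * (2 ^ k * t) powr (1 / p - 1)"
          and b = "\<lambda>k. B * (2 ^ k * t) powr (- \<alpha> - 1 / p)"
          and E = "\<lambda>k. {x \<in> space M. 2 ^ k * t \<le> \<sigma> x}"])
      fix k :: nat
      show "emeasure M {x \<in> space M. 2 ^ k * t \<le> \<sigma> x} \<le> ennreal (B * (2 ^ k * t) powr (- \<alpha> - 1 / p))"
        using t by (intro mass) simp
      have "(2 ^ k * t) powr (1 / p - 1) * (2 ^ k * t) powr (- \<alpha> - 1 / p)
          = (2 ^ k * t) powr (- 1 - \<alpha>)"
        by (simp flip: powr_add)
      also have "\<dots> = (2 powr (- 1 - \<alpha>)) ^ k * (t powr (- \<alpha>) / t)"
      proof -
        have "(2 ^ k * t) powr (- 1 - \<alpha>) = (2 ^ k) powr (- 1 - \<alpha>) * t powr (- 1 - \<alpha>)"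
          by (rule powr_mult)
        moreover have "(2 ^ k) powr (- 1 - \<alpha>) = (2 powr (- 1 - \<alpha>)) ^ k"
          by (simp add: powr_powr mult.commute flip: powr_realpow)
        moreover have "t powr (- 1 - \<alpha>) = t powr (- \<alpha>) / t"
          using t powr_add[of t "- 1" "- \<alpha>"] by (simp add: powr_minus_divide)
        ultimately show ?thesis by simp
      qed
      finally show "t * (2 ^ k * t) powr (1 / p - 1) * (B * (2 ^ k * t) powr (- \<alpha> - 1 / p))
          = B * t powr (- \<alpha>) * (2 powr (- 1 - \<alpha>)) ^ k"
        using t by (simp add: mult_ac)
    next
      fix x assume x: "x \<in> space M" "f1 x \<noteq> 0"
      then have "t \<le> \<sigma> x" by (auto simp: f1_def split: if_splits)
      then obtain k where k: "2 ^ k * t \<le> \<sigma> x" using dyadic_position t by metis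
      have "\<sigma> x powr (1 / p - 1) \<le> (2 ^ k * t) powr (1 / p - 1)"
        using k t p by (intro powr_mono2') auto
      then show "\<exists>k. x \<in> {x \<in> space M. 2 ^ k * t \<le> \<sigma> x} \<and> f1 x \<le> t * (2 ^ k * t) powr (1 / p - 1)"
        using x k t by (intro exI[of _ k]) (auto simp: f1_def)
    qed (use B t lt1 in auto)
    also have "B * t powr (- \<alpha>) / (1 - 2 powr (- 1 - \<alpha>)) = C1 * t powr (- \<alpha>)"
      by (simp add: C1_def)
    finally have 1: "(\<integral>\<^sup>+ x. ennreal (f1 x) \<partial>M) \<le> ennreal (C1 * t powr (- \<alpha>))" .
    have "(\<integral>\<^sup>+ x. ennreal (f2 x) \<partial>M) \<le> ennreal (B * 2 powr \<beta> * t powr (- \<alpha>) / (1 - 2 powr (\<beta> - 1)))"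
    proof (rule nn_integral_le_geometric_layers
        [where a = "\<lambda>k. t / 2 ^ k * t powr (1 / p - 1)"
          and b = "\<lambda>k. B * (t / 2 ^ Suc k) powr (- \<alpha> - 1 / p)"
          and E = "\<lambda>k. {x \<in> space M. t / 2 ^ Suc k \<le> \<sigma> x}"])
      fix k :: nat
      show "emeasure M {x \<in> space M. t / 2 ^ Suc k \<le> \<sigma> x} \<le> ennreal (B * (t / 2 ^ Suc k) powr (- \<alpha> - 1 / p))"
        using t by (intro mass) simp
      have "(t / 2 ^ Suc k) powr (- \<alpha> - 1 / p) = t powr (- \<beta>) * (2 powr \<beta> * (2 powr \<beta>) ^ k)"
      proof -
        have "(t / 2 ^ Suc k) powr (- \<beta>) = t powr (- \<beta>) / (2 ^ Suc k) powr (- \<beta>)"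
          by (rule powr_divide)
        also have "(2 ^ Suc k :: real) powr (- \<beta>) = 1 / (2 ^ Suc k) powr \<beta>"
          by (rule powr_minus_divide)
        also have "(2 ^ Suc k :: real) powr \<beta> = (2 powr \<beta>) ^ Suc k"
          by (simp add: powr_powr mult.commute flip: powr_realpow del: power_Suc of_nat_Suc)
        finally show ?thesis by (simp add: \<beta>_def)
      qed
      moreover have "(2 powr (\<beta> - 1)) ^ k = (2 powr \<beta>) ^ k / 2 ^ k"
        by (simp add: powr_diff power_divide)
      moreover have "t * t powr (1 / p - 1) * t powr (- \<beta>) = t powr (- \<alpha>)"
      proof -
        have "t * t powr (1 / p - 1) = t powr (1 / p)"
          using t powr_add[of t 1 "1 / p - 1"] by simp
        then show ?thesis by (simp add: \<beta>_def flip: powr_add)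
      qed
      ultimately show "t / 2 ^ k * t powr (1 / p - 1) * (B * (t / 2 ^ Suc k) powr (- \<alpha> - 1 / p))
          = B * 2 powr \<beta> * t powr (- \<alpha>) * (2 powr (\<beta> - 1)) ^ k"
        by (simp del: power_Suc)
    next
      fix x assume x: "x \<in> space M" "f2 x \<noteq> 0"
      then have "\<sigma> x < t" by (auto simp: f2_def split: if_splits)
      then obtain k where k: "2 ^ k * \<sigma> x \<le> t" "t < 2 ^ Suc k * \<sigma> x"
        using dyadic_position[of "\<sigma> x" t] \<sigma> x by auto
      then have "\<sigma> x \<le> t / 2 ^ k" "t / 2 ^ Suc k \<le> \<sigma> x" by (simp_all add: field_simps)
      then show "\<exists>k. x \<in> {x \<in> space M. t / 2 ^ Suc k \<le> \<sigma> x} \<and> f2 x \<le> t / 2 ^ k * t powr (1 / p - 1)"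
        using x t mult_right_mono[of "\<sigma> x" "t / 2 ^ k" "t powr (1 / p - 1)"]
        by (intro exI[of _ k]) (auto simp: f2_def)
    qed (use B t lt1 in auto)
    also have "B * 2 powr \<beta> * t powr (- \<alpha>) / (1 - 2 powr (\<beta> - 1)) = C2 * t powr (- \<alpha>)"
      by (simp add: C2_def)
    finally have 2: "(\<integral>\<^sup>+ x. ennreal (f2 x) \<partial>M) \<le> ennreal (C2 * t powr (- \<alpha>))" .
    have "(\<integral>\<^sup>+ x. ennreal (radial_weight p (\<sigma> x) t) \<partial>M)
        = (\<integral>\<^sup>+ x. ennreal (f1 x) + ennreal (f2 x) \<partial>M)"
      using nonneg by (intro nn_integral_cong) (simp only: split ennreal_plus)
    also have "\<dots> = (\<integral>\<^sup>+ x. ennreal (f1 x) \<partial>M) + (\<integral>\<^sup>+ x. ennreal (f2 x) \<partial>M)"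
      by (intro nn_integral_add) measurable
    also have "\<dots> \<le> ennreal (C1 * t powr (- \<alpha>)) + ennreal (C2 * t powr (- \<alpha>))"
      by (intro add_mono 1 2)
    also have "\<dots> = ennreal ((C1 + C2) * t powr (- \<alpha>))"
      using C12 by (simp add: distrib_right)
    finally show ?thesis .
  qed
  moreover have "ennreal ((C1 + C2) * t powr (- \<alpha>)) \<le> ennreal ((C1 + C2 + 1) * t powr (- \<alpha>))" for t
    by (intro ennreal_leI mult_right_mono) auto
  ultimately show ?thesis using that[of "C1 + C2 + 1"] C12 by (meson order_trans add_nonneg_pos add_nonneg_nonneg zero_less_one)
qed

section \<open>Masses in Stolz angles\<close>

text \<open>
  By Lindelof's theorem the complement of the support is a countable union of open null sets.
\<close>
lemma AE_in_measure_support: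
  fixes \<mu> :: "'a :: second_countable_topology measure"
  assumes sets: "sets \<mu> = sets (restrict_space borel (space \<mu>))"
  shows "AE x in \<mu>. x \<in> measure_support \<mu>"
proof -
  define F where "F = {U. open U \<and> emeasure \<mu> (U \<inter> space \<mu>) = 0}"
  have op: "open U" if "U \<in> F" for U using that by (simp add: F_def)
  obtain F' where F': "F' \<subseteq> F" "countable F'" "\<Union>F' = \<Union>F"
    by (rule Lindelof[OF op])
  have "U \<inter> space \<mu> \<in> null_sets \<mu>" if "U \<in> F'" for U
  proof (rule null_setsI)
    show "emeasure \<mu> (U \<inter> space \<mu>) = 0" using that F'(1) by (auto simp: F_def)
    have "U \<in> sets borel" using that F'(1) by (auto simp: F_def)
    then have "space \<mu> \<inter> U \<in> sets (restrict_space borel (space \<mu>))"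
      unfolding sets_restrict_space by (rule imageI)
    then show "U \<inter> space \<mu> \<in> sets \<mu>" using assms by (simp only: Int_commute)
  qed
  then have "(\<Union>U\<in>F'. U \<inter> space \<mu>) \<in> null_sets \<mu>"
    using F'(2) by (intro null_sets_UN') auto
  moreover have "{x \<in> space \<mu>. x \<notin> measure_support \<mu>} \<subseteq> (\<Union>U\<in>F'. U \<inter> space \<mu>)"
    using F'(3) by (auto simp: measure_support_def F_def)
  ultimately show ?thesis by (rule AE_I')
qed

lemma ennreal_le_divide_of_mult_le:
  assumes "0 < a" "0 \<le> b" "ennreal a * x \<le> ennreal b"
  shows "x \<le> ennreal (b / a)"
proof (cases x)
  case (real y)
  then have "a * y \<le> b" using assms by (simp flip: ennreal_mult)
  then show ?thesis using real assms(1) by (simp add: ennreal_leI field_simps)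
next
  case top
  then show ?thesis using assms by (simp add: ennreal_mult_top top_unique)
qed

text \<open>
  Positive \<open>C\<close> and the bound \<open>t0 \<le> 1/2\<close> are normalisations that spare case distinctions later.
\<close>
lemma bigo_at_left_one_powr_iff:
  "bigo_at_left_one f (\<lambda>r. (1 - r) powr a) \<longleftrightarrow>
    (\<exists>C>0. \<exists>t0>0. t0 \<le> 1 / 2 \<and> (\<forall>t. 0 < t \<longrightarrow> t \<le> t0 \<longrightarrow> f (1 - t) \<le> ennreal (C * t powr a)))"
    (is "_ \<longleftrightarrow> ?R")
proof
  assume "bigo_at_left_one f (\<lambda>r. (1 - r) powr a)"
  then obtain C b where b: "b < 1" "\<And>r. b < r \<Longrightarrow> r < 1 \<Longrightarrow> f r \<le> ennreal (C * (1 - r) powr a)"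
    unfolding bigo_at_left_one_def using eventually_at_left[of 0 "1::real"] by auto
  have "f (1 - t) \<le> ennreal ((\<bar>C\<bar> + 1) * t powr a)" if "0 < t" "t \<le> min (1 / 2) ((1 - b) / 2)" for t
  proof -
    have "f (1 - t) \<le> ennreal (C * t powr a)" using b(1) b(2)[of "1 - t"] that by simp
    also have "\<dots> \<le> ennreal ((\<bar>C\<bar> + 1) * t powr a)" by (intro ennreal_leI mult_right_mono) auto
    finally show ?thesis .
  qed
  then show ?R using b(1) by (intro exI[of _ "\<bar>C\<bar> + 1"] conjI exI[of _ "min (1 / 2) ((1 - b) / 2)"]) auto
next
  assume ?R
  then obtain C t0 where t0: "0 < t0" "t0 \<le> 1 / 2" and
    *: "\<And>t. 0 < t \<Longrightarrow> t \<le> t0 \<Longrightarrow> f (1 - t) \<le> ennreal (C * t powr a)" by blast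
  have "f r \<le> ennreal (C * (1 - r) powr a)" if "1 - t0 < r" "r < 1" for r
    using *[of "1 - r"] that by simp
  then show "bigo_at_left_one f (\<lambda>r. (1 - r) powr a)"
    unfolding bigo_at_left_one_def using eventually_at_left[of 0 "1::real"] t0
    by (intro exI[of _ C]) (auto intro!: exI[of _ "1 - t0"])
qed

text \<open>
  The constant \<open>A = M / (1 - 2^(-\<beta>))\<close> solves \<open>A 2^(-\<beta>) + M = A\<close>, so the bound reproduces itself under
  one step from \<open>2 t\<close> to \<open>t\<close>; the induction is on the number of doublings that take \<open>t\<close> beyond \<open>t0\<close>.
\<close>
lemma dyadic_recursion_bound:
  fixes n :: "real \<Rightarrow> ennreal" and \<beta> M t t0 :: real
  assumes \<beta>: "0 < \<beta>" and M: "0 \<le> M"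
    and antimono: "\<And>t. t0 \<le> t \<Longrightarrow> n t \<le> n t0"
    and step: "\<And>t. 0 < t \<Longrightarrow> t \<le> t0 \<Longrightarrow> n t \<le> n (2 * t) + ennreal (M * t powr (- \<beta>))"
    and t: "0 < t" "t \<le> t0"
  shows "n t \<le> n t0 + ennreal (M / (1 - 2 powr (- \<beta>)) * t powr (- \<beta>))"
proof -
  define A where "A = M / (1 - 2 powr (- \<beta>))"
  have lt1: "2 powr (- \<beta>) < (1::real)" using \<beta> by (intro powr_less_one) auto
  have "A * (1 - 2 powr (- \<beta>)) = M"
    unfolding A_def using lt1 by (intro nonzero_eq_divide_eq[THEN iffD1]) auto
  then have A: "0 \<le> A" "A * 2 powr (- \<beta>) + M = A"
    using lt1 M by (simp add: A_def, simp add: algebra_simps)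
  have "n t \<le> n t0 + ennreal (A * t powr (- \<beta>))"
    if "0 < t" "t \<le> t0" "t0 < 2 ^ k * t" for k t
    using that
  proof (induction k arbitrary: t)
    case (Suc k)
    have "n (2 * t) \<le> n t0 + ennreal (A * (2 * t) powr (- \<beta>))"
    proof (cases "2 * t \<le> t0")
      case True
      then show ?thesis using Suc.prems by (intro Suc.IH) (auto simp: mult_ac)
    next
      case False
      then have "n (2 * t) \<le> n t0" by (intro antimono) simp
      then show ?thesis by (simp add: add_increasing2)
    qed
    then have "n t \<le> (n t0 + ennreal (A * (2 * t) powr (- \<beta>))) + ennreal (M * t powr (- \<beta>))"
      using step[OF Suc.prems(1,2)] by (meson add_right_mono order_trans)
    also have "\<dots> = n t0 + ennreal (A * (2 * t) powr (- \<beta>) + M * t powr (- \<beta>))"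
      using A M by (simp add: add.assoc)
    also have "A * (2 * t) powr (- \<beta>) + M * t powr (- \<beta>) = (A * 2 powr (- \<beta>) + M) * t powr (- \<beta>)"
      by (simp add: powr_mult algebra_simps)
    finally show ?case by (simp only: A(2))
  qed simp
  moreover obtain k where "t0 < 2 ^ Suc k * t" using dyadic_position[OF t] by metis
  ultimately show ?thesis using t unfolding A_def by blast
qed

text \<open>
  Since \<open>1 - z cnj \<zeta> = (1 - \<xi> cnj \<zeta>) + (\<xi> - z) cnj \<zeta>\<close> and \<open>\<bar>1 - \<xi> cnj \<zeta>\<bar> = \<bar>\<xi> - \<zeta>\<bar>\<close>, the aperture of the
  angle gives \<open>N = \<bar>1 - z cnj \<zeta>\<bar> \<le> 2 (c + 2) t\<close>, while \<open>A = (1 - \<bar>z\<bar>^2) (1 - \<bar>\<zeta>\<bar>^2) \<ge> t^2\<close>. The kernel is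
  \<open>- ln (1 - A / N^2) / 2\<close>, hence at least \<open>A / (2 N^2)\<close>.
\<close>
lemma green_kernel_ge_in_stolz_angle:
  assumes \<xi>: "norm \<xi> = 1" and c: "1 < c" and \<zeta>: "\<zeta> \<in> stolz_angle \<xi> c"
    and t: "0 < t" "t \<le> 1" and layer: "t \<le> 1 - norm \<zeta>" "1 - norm \<zeta> < 2 * t"
    and z: "norm z = 1 - t" "norm (\<xi> - z) \<le> 2 * t"
  shows "ennreal (1 / (8 * (c + 2)\<^sup>2)) \<le> green_kernel z \<zeta>"
proof (cases "z = \<zeta>")
  case True
  then show ?thesis by (simp add: green_kernel_def log_kernel_def)
next
  case False
  define s where "s = 1 - norm \<zeta>"
  define A where "A = (1 - (norm z)\<^sup>2) * (1 - (norm \<zeta>)\<^sup>2)"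
  define N where "N = norm (1 - z * cnj \<zeta>)"
  define d where "d = norm (z - \<zeta>)"
  have d: "0 < d" using False by (simp add: d_def)
  have s: "t \<le> s" "s < 2 * t" "norm \<zeta> \<le> 1" using layer t by (auto simp: s_def)
  have N2: "N\<^sup>2 = d\<^sup>2 + A" unfolding N_def d_def A_def by (rule norm_one_minus_mult_cnj)
  have "1 - (norm z)\<^sup>2 = (2 - t) * t" "1 - (norm \<zeta>)\<^sup>2 = (2 - s) * s"
    by (simp_all add: z(1) s_def algebra_simps power2_eq_square)
  then have "(1 * t) * (1 * t) \<le> A"
    unfolding A_def using s t by (simp only:) (intro mult_mono, auto simp: s_def)
  then have A: "t\<^sup>2 \<le> A" by (simp add: power2_eq_square)
  have "norm (1 - \<xi> * cnj \<zeta>) = norm (\<xi> * cnj (\<xi> - \<zeta>))"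
    using \<xi> complex_norm_square[of \<xi>] by (simp add: algebra_simps)
  also have "\<dots> = norm (\<xi> - \<zeta>)" using \<xi> by (simp only: norm_mult complex_mod_cnj mult_1)
  also have "\<dots> < c * s" using \<zeta> by (simp add: stolz_angle_def s_def)
  finally have 1: "norm (1 - \<xi> * cnj \<zeta>) < c * s" .
  have "norm ((\<xi> - z) * cnj \<zeta>) \<le> (2 * t) * 1"
    unfolding norm_mult using z(2) s(3) t by (intro mult_mono) auto
  moreover have "1 - z * cnj \<zeta> = (1 - \<xi> * cnj \<zeta>) + (\<xi> - z) * cnj \<zeta>" by (simp add: algebra_simps)
  then have "N \<le> norm (1 - \<xi> * cnj \<zeta>) + norm ((\<xi> - z) * cnj \<zeta>)"
    unfolding N_def by (simp only: norm_triangle_ineq)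
  ultimately have "N \<le> c * s + 2 * t" using 1 by linarith
  also have "c * s \<le> c * (2 * t)" using s c by (intro mult_left_mono) auto
  then have "c * s + 2 * t \<le> (c + 2) * (2 * t)" using t by (simp add: algebra_simps)
  finally have "N\<^sup>2 \<le> ((c + 2) * (2 * t))\<^sup>2" by (intro power_mono) (auto simp: N_def)
  also have "\<dots> = 4 * (c + 2)\<^sup>2 * t\<^sup>2" by (simp add: power_mult_distrib)
  also have "\<dots> \<le> 4 * (c + 2)\<^sup>2 * A" using A by (intro mult_left_mono) auto
  finally have "N\<^sup>2 \<le> 4 * (c + 2)\<^sup>2 * A" .
  moreover have "0 < A" using A t by (meson less_le_trans zero_less_power)
  moreover have N2pos: "0 < N\<^sup>2" using d \<open>0 < A\<close> by (simp add: N2 add_pos_pos)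
  ultimately have "1 / (4 * (c + 2)\<^sup>2) \<le> A / N\<^sup>2" using c by (simp add: field_simps)
  also have "A / N\<^sup>2 \<le> ln (1 + A / d\<^sup>2)"
  proof -
    have "1 + A / d\<^sup>2 = N\<^sup>2 / d\<^sup>2" using d by (simp add: N2 field_simps)
    moreover have "ln (d\<^sup>2 / N\<^sup>2) \<le> d\<^sup>2 / N\<^sup>2 - 1" using d N2pos by (intro ln_le_minus_one) simp
    moreover have "d\<^sup>2 / N\<^sup>2 + A / N\<^sup>2 = 1"
      using N2pos N2 by (simp flip: add_divide_distrib)
    moreover have "ln (d\<^sup>2 / N\<^sup>2) = - ln (N\<^sup>2 / d\<^sup>2)" using d N2pos by (simp add: ln_div)
    ultimately show ?thesis by simp
  qed
  finally have "1 / (8 * (c + 2)\<^sup>2) \<le> ln (1 + A / d\<^sup>2) / 2" by (simp add: field_simps)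
  then show ?thesis
    using green_kernel_eq_ln[of z \<zeta>] False z t layer
    by (simp add: A_def d_def ennreal_leI)
qed

lemma e2ennreal_abs_green_potential:
  "e2ennreal \<bar>green_potential \<mu> z\<bar> = (\<integral>\<^sup>+ \<zeta>. green_kernel z \<zeta> \<partial>\<mu>)"
  unfolding green_potential_def green_kernel_def
  by (simp only: abs_ereal_uminus abs_ereal_ge0 enn2ereal_nonneg e2ennreal_enn2ereal)

text \<open>
  The points at angles within \<open>t\<close> of the vertex contain an arc of length \<open>t\<close> with angles in \<open>[0, 2 pi]\<close>,
  to one side of the vertex. On this arc \<open>\<bar>u\<bar>\<close> is at least a constant times the mass of \<open>E\<close>.
\<close>
lemma mass_layer_le_integral_mean:
  fixes \<mu> :: "complex measure" and u :: "complex \<Rightarrow> ereal"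
  assumes sets: "sets \<mu> = sets (restrict_space borel (ball 0 1))"
    and u: "\<And>z. z \<in> ball 0 1 \<Longrightarrow> u z = green_potential \<mu> z"
    and p: "1 < p" and \<xi>: "norm \<xi> = 1" and c: "1 < c" and t: "0 < t" "t < 1"
    and E: "E = {\<zeta> \<in> stolz_angle \<xi> c. t \<le> 1 - norm \<zeta> \<and> 1 - norm \<zeta> < 2 * t}"
  shows "ennreal ((t / (2 * pi)) powr (1 / p) * (1 / (8 * (c + 2)\<^sup>2))) * emeasure \<mu> E
    \<le> integral_mean p (1 - t) u"
proof -
  define \<kappa> where "\<kappa> = 1 / (8 * (c + 2)\<^sup>2)"
  have \<kappa>: "0 \<le> \<kappa>" by (simp add: \<kappa>_def)
  define \<phi> where "\<phi> = Arg2pi \<xi>"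
  have \<xi>_eq: "\<xi> = cis \<phi>"
    unfolding \<phi>_def cis_conv_exp using Arg2pi_eq[of \<xi>] \<xi> by (simp add: mult.commute)
  have \<phi>: "0 \<le> \<phi>" "\<phi> < 2 * pi" using Arg2pi[of \<xi>] by (auto simp: \<phi>_def)
  obtain a where a: "{a..a + t} \<subseteq> {0..2 * pi}" "{a..a + t} \<subseteq> {\<phi> - t..\<phi> + t}"
  proof (cases "\<phi> \<le> pi")
    case True
    then show ?thesis using that[of \<phi>] \<phi> t pi_gt3 by auto
  next
    case False
    then show ?thesis using that[of "\<phi> - t"] \<phi> t pi_gt3 by auto
  qed
  have "stolz_angle \<xi> c \<inter> {\<zeta>. t \<le> 1 - norm \<zeta> \<and> 1 - norm \<zeta> < 2 * t} \<in> sets borel"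
    unfolding stolz_angle_def by measurable
  moreover have "E \<subseteq> ball 0 1" by (auto simp: E stolz_angle_def)
  ultimately have [measurable]: "E \<in> sets \<mu>"
    by (simp add: sets sets_restrict_space_iff E Int_def)
  have low: "ennreal \<kappa> * emeasure \<mu> E \<le> e2ennreal \<bar>u (of_real (1 - t) * cis \<theta>)\<bar>"
    if \<theta>: "\<theta> \<in> {a..a + t}" for \<theta>
  proof -
    define z where "z = of_real (1 - t) * cis \<theta>"
    have nz: "norm z = 1 - t" using t by (simp add: z_def norm_mult del: of_real_diff)
    have "\<xi> - z = (cis \<phi> - cis \<theta>) + of_real t * cis \<theta>"
      by (simp add: \<xi>_eq z_def algebra_simps)
    then have "norm (\<xi> - z) \<le> norm (cis \<phi> - cis \<theta>) + norm (of_real t * cis \<theta>)"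
      by (simp only: norm_triangle_ineq)
    also have "norm (cis \<phi> - cis \<theta>) \<le> t"
    proof -
      have "\<bar>\<phi> - \<theta>\<bar> \<le> t" using a(2) \<theta> by (auto simp: abs_le_iff)
      then show ?thesis
        using norm_cis_diff[of \<phi> \<theta>] abs_sin_x_le_abs_x[of "(\<phi> - \<theta>) / 2"] by simp
    qed
    also have "norm (of_real t * cis \<theta>) = t" using t by (simp add: norm_mult)
    finally have z\<xi>: "norm (\<xi> - z) \<le> 2 * t" by simp
    have "ennreal \<kappa> * emeasure \<mu> E = (\<integral>\<^sup>+ \<zeta>. ennreal \<kappa> * indicator E \<zeta> \<partial>\<mu>)"
      by (simp add: nn_integral_cmult_indicator)
    also have "\<dots> \<le> (\<integral>\<^sup>+ \<zeta>. green_kernel z \<zeta> \<partial>\<mu>)"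
    proof (rule nn_integral_mono)
      fix \<zeta>
      show "ennreal \<kappa> * indicator E \<zeta> \<le> green_kernel z \<zeta>"
        using green_kernel_ge_in_stolz_angle[OF \<xi> c, of \<zeta> t z] t nz z\<xi>
        by (auto simp: indicator_def E \<kappa>_def)
    qed
    also have "\<dots> = e2ennreal \<bar>u z\<bar>"
      using u[of z] nz t by (simp add: e2ennreal_abs_green_potential)
    finally show ?thesis by (simp only: z_def)
  qed
  have "ennreal t * ennreal_powr (ennreal \<kappa> * emeasure \<mu> E) p
    = (\<integral>\<^sup>+ \<theta>. ennreal_powr (ennreal \<kappa> * emeasure \<mu> E) p * indicator {a..a + t} \<theta> \<partial>lborel)"
    using t by (subst nn_integral_cmult_indicator) (auto simp: mult.commute)
  also have "\<dots> \<le> (\<integral>\<^sup>+ \<theta>\<in>{0..2 * pi}.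
      ennreal_powr (e2ennreal \<bar>u (of_real (1 - t) * cis \<theta>)\<bar>) p \<partial>lborel)"
  proof (rule nn_integral_mono)
    fix \<theta>
    show "ennreal_powr (ennreal \<kappa> * emeasure \<mu> E) p * indicator {a..a + t} \<theta>
      \<le> ennreal_powr (e2ennreal \<bar>u (of_real (1 - t) * cis \<theta>)\<bar>) p * indicator {0..2 * pi} \<theta>"
    proof (cases "\<theta> \<in> {a..a + t}")
      case True
      then have "\<theta> \<in> {0..2 * pi}" using a(1) by blast
      with True show ?thesis using low[OF True] p by (simp add: ennreal_powr_mono)
    qed simp
  qed
  finally have "ennreal_powr (ennreal (1 / (2 * pi)) * (ennreal t * ennreal_powr (ennreal \<kappa> * emeasure \<mu> E) p)) (1 / p)
      \<le> integral_mean p (1 - t) u"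
    unfolding integral_mean_def using p by (intro ennreal_powr_mono mult_left_mono) auto
  also have "ennreal (1 / (2 * pi)) * (ennreal t * ennreal_powr (ennreal \<kappa> * emeasure \<mu> E) p)
      = ennreal (t / (2 * pi)) * ennreal_powr (ennreal \<kappa> * emeasure \<mu> E) p"
    using t by (simp add: mult.assoc[symmetric] flip: ennreal_mult)
  also have "ennreal_powr (ennreal (t / (2 * pi)) * ennreal_powr (ennreal \<kappa> * emeasure \<mu> E) p) (1 / p)
      = ennreal ((t / (2 * pi)) powr (1 / p)) * (ennreal \<kappa> * emeasure \<mu> E)"
    using p t by (subst ennreal_powr_mult, subst ennreal_powr_inverse) auto
  also have "\<dots> = ennreal ((t / (2 * pi)) powr (1 / p) * \<kappa>) * emeasure \<mu> E"
    using \<kappa> by (subst ennreal_mult) (auto simp: mult.assoc)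
  finally show ?thesis by (simp only: \<kappa>_def)
qed

theorem theorem3:
  fixes \<mu> :: "complex measure" and u :: "complex \<Rightarrow> ereal" and \<alpha> p :: real
  assumes borel_disc: "sets \<mu> = sets (restrict_space borel (ball (0::complex) 1))"
    and finite_mass: "(\<integral>\<^sup>+ \<zeta>. ennreal (1 - norm \<zeta>) \<partial>\<mu>) < \<infinity>"
    and u: "\<And>z. z \<in> ball 0 1 \<Longrightarrow> u z = green_potential \<mu> z"
    and \<alpha>: "0 \<le> \<alpha>" "\<alpha> < 1"
    and p: "1 < p"
    and \<alpha>p: "\<alpha> + 1 / p < 1"
    and supp: "\<exists>S. finite S \<and> (\<forall>(\<xi>, c) \<in> S. norm \<xi> = 1 \<and> 1 < c) \<and>
                 measure_support \<mu> \<subseteq> (\<Union>(\<xi>, c) \<in> S. stolz_angle \<xi> c)"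
  shows "bigo_at_left_one (\<lambda>r. integral_mean p r u) (\<lambda>r. (1 - r) powr (- \<alpha>)) \<longleftrightarrow>
         bigo_at_left_one (\<lambda>r. emeasure \<mu> (closure (ball 0 r))) (\<lambda>r. (1 - r) powr (- \<alpha> - 1 / p))"
proof -
  define \<beta> where "\<beta> = \<alpha> + 1 / p"
  have \<beta>: "0 < \<beta>" "- \<alpha> - 1 / p = - \<beta>" using \<alpha> p by (auto simp: \<beta>_def intro: add_nonneg_pos)
  have space: "space \<mu> = ball 0 1"
    using sets_eq_imp_space_eq[OF borel_disc] by (simp add: space_restrict_space)
  have id_meas [measurable]: "(\<lambda>\<zeta>. \<zeta>) \<in> borel_measurable \<mu>"
    unfolding measurable_cong_sets[OF borel_disc refl]
    by (intro measurable_restrict_space1) simp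
  define n where "n \<tau> = emeasure \<mu> {\<zeta> \<in> space \<mu>. \<tau> \<le> 1 - norm \<zeta>}" for \<tau>
  have n_closed_disc: "emeasure \<mu> (closure (ball 0 (1 - t))) = n t" if "0 < t" "t < 1" for t
    using that unfolding n_def by (intro arg_cong[of _ _ "emeasure \<mu>"]) (auto simp: space)
  have n_finite: "n \<tau> < \<infinity>" if "0 < \<tau>" for \<tau>
  proof -
    have "ennreal \<tau> * n \<tau> = (\<integral>\<^sup>+ \<zeta>. ennreal \<tau> * indicator {\<zeta> \<in> space \<mu>. \<tau> \<le> 1 - norm \<zeta>} \<zeta> \<partial>\<mu>)"
      unfolding n_def by (intro nn_integral_cmult_indicator[symmetric]) measurable
    also have "\<dots> \<le> (\<integral>\<^sup>+ \<zeta>. ennreal (1 - norm \<zeta>) \<partial>\<mu>)"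
      by (intro nn_integral_mono) (auto simp: indicator_def intro: ennreal_leI)
    finally have "ennreal \<tau> * n \<tau> < \<infinity>" using finite_mass by (rule order.strict_trans1)
    then show ?thesis using that by (auto simp: ennreal_mult_less_top)
  qed
  have n_antimono: "n \<tau>' \<le> n \<tau>" if "\<tau> \<le> \<tau>'" for \<tau> \<tau>'
    unfolding n_def using that by (intro emeasure_mono) auto
  have sigma_finite: "sigma_finite_measure \<mu>"
  proof
    have "\<exists>k. 1 / real (Suc k) \<le> 1 - norm \<zeta>" if "\<zeta> \<in> space \<mu>" for \<zeta>
      using that reals_Archimedean[of "1 - norm \<zeta>"] by (auto simp: space inverse_eq_divide intro: less_imp_le)
    then show "\<exists>A. countable A \<and> A \<subseteq> sets \<mu> \<and> \<Union>A = space \<mu> \<and> (\<forall>a\<in>A. emeasure \<mu> a \<noteq> \<infinity>)"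
      using n_finite
      by (intro exI[of _ "range (\<lambda>k. {\<zeta> \<in> space \<mu>. 1 / real (Suc k) \<le> 1 - norm \<zeta>})"])
         (auto simp: n_def less_top simp del: of_nat_Suc)
  qed
  have counting_iff: "bigo_at_left_one (\<lambda>r. emeasure \<mu> (closure (ball 0 r))) (\<lambda>r. (1 - r) powr (- \<alpha> - 1 / p))
      \<longleftrightarrow> (\<exists>C>0. \<exists>t0>0. t0 \<le> 1 / 2 \<and> (\<forall>t. 0 < t \<longrightarrow> t \<le> t0 \<longrightarrow> n t \<le> ennreal (C * t powr (- \<beta>))))"
  proof -
    have "(\<forall>t. 0 < t \<longrightarrow> t \<le> t0 \<longrightarrow> emeasure \<mu> (closure (ball 0 (1 - t))) \<le> ennreal (C * t powr (- \<beta>)))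
      \<longleftrightarrow> (\<forall>t. 0 < t \<longrightarrow> t \<le> t0 \<longrightarrow> n t \<le> ennreal (C * t powr (- \<beta>)))" if "t0 \<le> 1 / 2" for C t0
      using that n_closed_disc by (intro iff_allI) auto
    then show ?thesis unfolding bigo_at_left_one_powr_iff \<beta>(2) by (meson order_refl)
  qed
  show ?thesis
    unfolding counting_iff unfolding bigo_at_left_one_powr_iff
  proof
    assume "\<exists>C>0. \<exists>t0>0. t0 \<le> 1 / 2 \<and> (\<forall>t. 0 < t \<longrightarrow> t \<le> t0 \<longrightarrow>
      integral_mean p (1 - t) u \<le> ennreal (C * t powr (- \<alpha>)))"
    then obtain C t0 where C: "0 < C" and t0: "0 < t0" "t0 \<le> 1 / 2"
      and mean: "\<And>t. 0 < t \<Longrightarrow> t \<le> t0 \<Longrightarrow> integral_mean p (1 - t) u \<le> ennreal (C * t powr (- \<alpha>))"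
      by blast
    obtain S where S: "finite S" "\<And>\<xi> c. (\<xi>, c) \<in> S \<Longrightarrow> norm \<xi> = 1 \<and> 1 < c"
      and S_supp: "measure_support \<mu> \<subseteq> (\<Union>(\<xi>, c) \<in> S. stolz_angle \<xi> c)"
      using supp by (fastforce simp: case_prod_beta)
    define D where "D c = C * (2 * pi) powr (1 / p) * (8 * (c + 2)\<^sup>2)" for c :: real
    define M where "M = (\<Sum>(\<xi>, c)\<in>S. D c)"
    have D: "0 \<le> D c" for c using C by (simp add: D_def)
    have M: "0 \<le> M" unfolding M_def using D by (intro sum_nonneg) (auto simp: case_prod_beta)
    \<comment> \<open>Almost all of the mass of the layer \<open>t \<le> 1 - norm \<zeta> < 2 t\<close> lies in the Stolz angles.\<close>
    have step: "n t \<le> n (2 * t) + ennreal (M * t powr (- \<beta>))" if t: "0 < t" "t \<le> t0" for t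
    proof -
      define L where "L = {\<zeta> \<in> space \<mu>. t \<le> 1 - norm \<zeta> \<and> 1 - norm \<zeta> < 2 * t}"
      define E where "E = (\<lambda>(\<xi>, c). {\<zeta> \<in> stolz_angle \<xi> c. t \<le> 1 - norm \<zeta> \<and> 1 - norm \<zeta> < 2 * t})"
      have [measurable]: "L \<in> sets \<mu>" unfolding L_def by measurable
      have E_sets: "E x \<in> sets \<mu>" for x
      proof -
        have "E x \<in> sets borel"
          unfolding E_def stolz_angle_def by (simp add: case_prod_beta)
        moreover have "E x \<subseteq> ball 0 1" by (auto simp: E_def stolz_angle_def split: prod.splits)
        ultimately show ?thesis by (simp add: borel_disc sets_restrict_space_iff)
      qed
      have E_mass: "emeasure \<mu> (E (\<xi>, c)) \<le> ennreal (D c * t powr (- \<beta>))" if "(\<xi>, c) \<in> S" for \<xi> c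
      proof -
        have \<xi>c: "norm \<xi> = 1" "1 < c" using S that by auto
        have "ennreal ((t / (2 * pi)) powr (1 / p) * (1 / (8 * (c + 2)\<^sup>2))) * emeasure \<mu> (E (\<xi>, c))
          \<le> integral_mean p (1 - t) u"
          using t t0 by (intro mass_layer_le_integral_mean[OF borel_disc u p \<xi>c]) (auto simp: E_def)
        also have "\<dots> \<le> ennreal (C * t powr (- \<alpha>))" using mean t by simp
        finally have "emeasure \<mu> (E (\<xi>, c))
          \<le> ennreal (C * t powr (- \<alpha>) / ((t / (2 * pi)) powr (1 / p) * (1 / (8 * (c + 2)\<^sup>2))))"
          using t C \<xi>c by (intro ennreal_le_divide_of_mult_le) (auto intro!: mult_pos_pos)
        also have "C * t powr (- \<alpha>) / ((t / (2 * pi)) powr (1 / p) * (1 / (8 * (c + 2)\<^sup>2)))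
          = D c * t powr (- \<beta>)"
        proof -
          have "t powr (- \<beta>) = t powr (- \<alpha>) / t powr (1 / p)"
            unfolding \<beta>(2)[symmetric] by (rule powr_diff)
          then show ?thesis by (simp add: D_def powr_divide)
        qed
        finally show ?thesis .
      qed
      have "AE \<zeta> in \<mu>. \<zeta> \<in> measure_support \<mu>"
        by (rule AE_in_measure_support) (simp add: space borel_disc)
      then have "AE \<zeta> in \<mu>. \<zeta> \<in> L \<longrightarrow> \<zeta> \<in> (\<Union>x\<in>S. E x)"
      proof (rule eventually_mono)
        fix \<zeta> assume "\<zeta> \<in> measure_support \<mu>"
        then obtain \<xi> c where "(\<xi>, c) \<in> S" "\<zeta> \<in> stolz_angle \<xi> c" using S_supp by blast
        then have "(\<xi>, c) \<in> S" "\<zeta> \<in> L \<Longrightarrow> \<zeta> \<in> E (\<xi>, c)" by (simp_all add: L_def E_def)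
        then show "\<zeta> \<in> L \<longrightarrow> \<zeta> \<in> (\<Union>x\<in>S. E x)" by blast
      qed
      then have "emeasure \<mu> L \<le> emeasure \<mu> (\<Union>x\<in>S. E x)"
        using E_sets S(1) by (intro emeasure_mono_AE sets.finite_UN) auto
      also have "\<dots> \<le> (\<Sum>x\<in>S. emeasure \<mu> (E x))"
        using E_sets S(1) by (intro emeasure_subadditive_finite) auto
      also have "\<dots> \<le> (\<Sum>(\<xi>, c)\<in>S. ennreal (D c * t powr (- \<beta>)))"
        using E_mass by (intro sum_mono) auto
      also have "\<dots> = ennreal (M * t powr (- \<beta>))"
        using D by (simp add: M_def sum_distrib_right case_prod_beta sum_ennreal)
      finally have L: "emeasure \<mu> L \<le> ennreal (M * t powr (- \<beta>))" .
      have "{\<zeta> \<in> space \<mu>. t \<le> 1 - norm \<zeta>} = {\<zeta> \<in> space \<mu>. 2 * t \<le> 1 - norm \<zeta>} \<union> L"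
        using t by (auto simp: L_def)
      then have "n t = emeasure \<mu> ({\<zeta> \<in> space \<mu>. 2 * t \<le> 1 - norm \<zeta>} \<union> L)"
        by (simp only: n_def)
      also have "\<dots> \<le> n (2 * t) + emeasure \<mu> L"
        unfolding n_def by (intro emeasure_subadditive) measurable
      also have "\<dots> \<le> n (2 * t) + ennreal (M * t powr (- \<beta>))" by (intro add_left_mono L)
      finally show ?thesis .
    qed
    define A where "A = M / (1 - 2 powr (- \<beta>))"
    have "2 powr (- \<beta>) < (1::real)" using \<beta> by (intro powr_less_one) auto
    then have A: "0 \<le> A" using M by (simp add: A_def)
    obtain N where N: "n t0 = ennreal N" "0 \<le> N"
      using n_finite[OF t0(1)] by (cases "n t0") auto
    have "n t \<le> ennreal ((N + A + 1) * t powr (- \<beta>))" if t: "0 < t" "t \<le> t0" for t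
    proof -
      have "1 \<le> t powr (- \<beta>)"
        using powr_mono2'[of "- \<beta>" t 1] t t0 \<beta> by simp
      then have "N \<le> N * t powr (- \<beta>)" using N(2) mult_left_mono[of 1 "t powr (- \<beta>)" N] by simp
      moreover have "n t \<le> n t0 + ennreal (A * t powr (- \<beta>))"
        unfolding A_def by (intro dyadic_recursion_bound \<beta> M step t n_antimono)
      then have "n t \<le> ennreal (N + A * t powr (- \<beta>))" using N A by simp
      moreover have "N + A * t powr (- \<beta>) \<le> (N + A + 1) * t powr (- \<beta>)"
        using calculation(1) by (simp add: distrib_right add_increasing2)
      ultimately show ?thesis by (meson ennreal_leI order_trans)
    qed
    then show "\<exists>C>0. \<exists>t0>0. t0 \<le> 1 / 2 \<and> (\<forall>t. 0 < t \<longrightarrow> t \<le> t0 \<longrightarrow> n t \<le> ennreal (C * t powr (- \<beta>)))"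
      using t0 A N by (intro exI[of _ "N + A + 1"] conjI exI[of _ t0]) auto
  next
    assume "\<exists>C>0. \<exists>t0>0. t0 \<le> 1 / 2 \<and> (\<forall>t. 0 < t \<longrightarrow> t \<le> t0 \<longrightarrow> n t \<le> ennreal (C * t powr (- \<beta>)))"
    then obtain C t0 where C: "0 < C" and t0: "0 < t0" "t0 \<le> 1 / 2"
      and count: "\<And>t. 0 < t \<Longrightarrow> t \<le> t0 \<Longrightarrow> n t \<le> ennreal (C * t powr (- \<beta>))" by blast
    obtain N where N: "n t0 = ennreal N" "0 \<le> N"
      using n_finite[OF t0(1)] by (cases "n t0") auto
    \<comment> \<open>Beyond \<open>t0\<close> the mass is at most \<open>N\<close>, and no point has \<open>1 - norm \<zeta> > 1\<close>, so the
      bound extends to all \<open>\<tau> > 0\<close>.\<close>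
    have mass: "emeasure \<mu> {\<zeta> \<in> space \<mu>. \<tau> \<le> 1 - norm \<zeta>} \<le> ennreal ((C + N) * \<tau> powr (- \<alpha> - 1 / p))"
      if \<tau>: "0 < \<tau>" for \<tau>
    proof -
      consider "\<tau> \<le> t0" | "t0 < \<tau>" "\<tau> \<le> 1" | "1 < \<tau>" by linarith
      then have "n \<tau> \<le> ennreal ((C + N) * \<tau> powr (- \<beta>))"
      proof cases
        case 1
        then have "n \<tau> \<le> ennreal (C * \<tau> powr (- \<beta>))" using count \<tau> by blast
        also have "\<dots> \<le> ennreal ((C + N) * \<tau> powr (- \<beta>))"
          using N by (intro ennreal_leI mult_right_mono) auto
        finally show ?thesis .
      next
        case 2
        then have "n \<tau> \<le> ennreal N" using n_antimono[of t0 \<tau>] N by simp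
        also have "1 \<le> \<tau> powr (- \<beta>)" using powr_mono2'[of "- \<beta>" \<tau> 1] 2 \<tau> \<beta> by simp
        then have "N \<le> (C + N) * \<tau> powr (- \<beta>)"
          using mult_mono[of N "C + N" 1 "\<tau> powr (- \<beta>)"] C N by simp
        finally show ?thesis by (simp add: ennreal_leI)
      next
        case 3
        then have "1 - norm \<zeta> < \<tau>" for \<zeta> :: complex using norm_ge_zero[of \<zeta>] by linarith
        then have "{\<zeta> \<in> space \<mu>. \<tau> \<le> 1 - norm \<zeta>} = {}" by (auto simp: not_le)
        then have "n \<tau> = 0" unfolding n_def by (simp only: emeasure_empty)
        then show ?thesis by simp
      qed
      then show ?thesis by (simp only: n_def \<beta>(2))
    qed
    have CN: "0 \<le> C + N" using C N by simp
    have height: "(\<lambda>\<zeta>. 1 - norm \<zeta>) \<in> borel_measurable \<mu>" by measurable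
    have height_pos: "0 < 1 - norm \<zeta>" if "\<zeta> \<in> space \<mu>" for \<zeta> using that by (simp add: space)
    obtain C1 where C1: "0 < C1" and layers: "\<And>t. 0 < t \<Longrightarrow>
        (\<integral>\<^sup>+ \<zeta>. ennreal (radial_weight p (1 - norm \<zeta>) t) \<partial>\<mu>) \<le> ennreal (C1 * t powr (- \<alpha>))"
      by (rule nn_integral_radial_weight_le[OF height height_pos p \<alpha>(1) \<alpha>p CN mass]) (assumption | rule that)+
    obtain C2 where C2: "0 < C2" and kernel_mean: "\<And>r \<zeta>. 1 / 2 \<le> r \<Longrightarrow> r < 1 \<Longrightarrow> norm \<zeta> < 1 \<Longrightarrow>
      (\<integral>\<^sup>+ \<theta>\<in>{0..2 * pi}. ennreal_powr (green_kernel (of_real r * cis \<theta>) \<zeta>) p \<partial>lborel)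
      \<le> ennreal ((C2 * radial_weight p (1 - norm \<zeta>) (1 - r)) powr p)"
      by (rule green_kernel_mean_bound[OF p]) (assumption | rule that)+
    have "integral_mean p (1 - t) u \<le> ennreal (C2 * C1 * t powr (- \<alpha>))"
      if t: "0 < t" "t \<le> 1 / 2" for t
    proof -
      define K where "K \<theta> \<zeta> = green_kernel (of_real (1 - t) * cis \<theta>) \<zeta> * indicator {0..2 * pi} \<theta>" for \<theta> \<zeta>
      define G where "G = C2 * C1 * t powr (- \<alpha>)"
      have G: "0 < G" using C1 C2 t by (simp add: G_def)
      have "(\<integral>\<^sup>+ \<theta>. ennreal_powr (\<integral>\<^sup>+ \<zeta>. K \<theta> \<zeta> \<partial>\<mu>) p \<partial>lborel) \<le> ennreal (G powr p)"
      proof -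
        have [measurable]: "(\<lambda>\<zeta>. radial_weight p (1 - norm \<zeta>) t) \<in> borel_measurable \<mu>"
          unfolding radial_weight_def by measurable
        show ?thesis
        proof (rule Minkowski_integral_inequality[where g = "\<lambda>\<zeta>. C2 * radial_weight p (1 - norm \<zeta>) t"])
          show "sigma_finite_measure lborel" ..
          have [measurable]: "(\<lambda>\<theta>. of_real (1 - t) * cis \<theta>) \<in> borel_measurable borel"
            by (intro borel_measurable_continuous_onI continuous_intros)
          show "(\<lambda>(\<theta>, \<zeta>). K \<theta> \<zeta>) \<in> borel_measurable (lborel \<Otimes>\<^sub>M \<mu>)"
            unfolding K_def by measurable
          show "(\<lambda>\<zeta>. C2 * radial_weight p (1 - norm \<zeta>) t) \<in> borel_measurable \<mu>"
            by measurable
          show "0 < C2 * radial_weight p (1 - norm \<zeta>) t" if "\<zeta> \<in> space \<mu>" for \<zeta>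
            using that t C2 by (auto simp: radial_weight_def space less_max_iff_disj intro!: mult_pos_pos divide_pos_pos)
          show "(\<integral>\<^sup>+ \<theta>. ennreal_powr (K \<theta> \<zeta>) p \<partial>lborel) \<le> ennreal ((C2 * radial_weight p (1 - norm \<zeta>) t) powr p)"
            if "\<zeta> \<in> space \<mu>" for \<zeta>
            using kernel_mean[of "1 - t" \<zeta>] that t by (simp add: K_def ennreal_powr_indicator space)
          have "(\<integral>\<^sup>+ \<zeta>. ennreal (C2 * radial_weight p (1 - norm \<zeta>) t) \<partial>\<mu>) = ennreal C2 * (\<integral>\<^sup>+ \<zeta>. ennreal (radial_weight p (1 - norm \<zeta>) t) \<partial>\<mu>)"
            using C2 by (simp add: ennreal_mult' nn_integral_cmult)
          also have "\<dots> \<le> ennreal C2 * ennreal (C1 * t powr (- \<alpha>))"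
            by (intro mult_left_mono layers t) simp
          finally show "(\<integral>\<^sup>+ \<zeta>. ennreal (C2 * radial_weight p (1 - norm \<zeta>) t) \<partial>\<mu>) \<le> ennreal G"
            using C1 C2 by (simp add: G_def mult.assoc flip: ennreal_mult)
        qed (use p G sigma_finite in auto)
      qed
      also have "(\<integral>\<^sup>+ \<theta>. ennreal_powr (\<integral>\<^sup>+ \<zeta>. K \<theta> \<zeta> \<partial>\<mu>) p \<partial>lborel)
        = (\<integral>\<^sup>+ \<theta>\<in>{0..2 * pi}. ennreal_powr (e2ennreal \<bar>u (of_real (1 - t) * cis \<theta>)\<bar>) p \<partial>lborel)"
      proof (rule nn_integral_cong)
        fix \<theta> :: real
        have "of_real (1 - t) * cis \<theta> \<in> ball 0 1"
          using t by (simp add: norm_mult del: of_real_diff)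
        then have "(\<integral>\<^sup>+ \<zeta>. green_kernel (of_real (1 - t) * cis \<theta>) \<zeta> \<partial>\<mu>)
            = e2ennreal \<bar>u (of_real (1 - t) * cis \<theta>)\<bar>"
          by (simp only: u e2ennreal_abs_green_potential)
        then show "ennreal_powr (\<integral>\<^sup>+ \<zeta>. K \<theta> \<zeta> \<partial>\<mu>) p
          = ennreal_powr (e2ennreal \<bar>u (of_real (1 - t) * cis \<theta>)\<bar>) p * indicator {0..2 * pi} \<theta>"
          by (cases "\<theta> \<in> {0..2 * pi}") (simp_all add: K_def)
      qed
      finally have *: "(\<integral>\<^sup>+ \<theta>\<in>{0..2 * pi}. ennreal_powr (e2ennreal \<bar>u (of_real (1 - t) * cis \<theta>)\<bar>) p \<partial>lborel)
        \<le> ennreal (G powr p)" .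
      have "integral_mean p (1 - t) u \<le> ennreal_powr (1 * ennreal (G powr p)) (1 / p)"
        unfolding integral_mean_def using p pi_gt3
        by (intro ennreal_powr_mono mult_mono *) auto
      also have "\<dots> = ennreal G" using G p by (simp add: powr_powr)
      finally show ?thesis by (simp only: G_def)
    qed
    then show "\<exists>C>0. \<exists>t0>0. t0 \<le> 1 / 2 \<and> (\<forall>t. 0 < t \<longrightarrow> t \<le> t0 \<longrightarrow>
      integral_mean p (1 - t) u \<le> ennreal (C * t powr (- \<alpha>)))"
      using C1 C2 by (intro exI[of _ "C2 * C1"] conjI exI[of _ "1 / 2"]) auto
  qed
qed

end
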